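(* Let $\mathcal{C}$ be an irrational combinatorial class that is primitive, and let $f_{\mathcal{C}}(z)$ be its irrational generating function, with radius of convergence $\rho$, where $0<\rho<1$. Suppose one can write \[ f_{\mathcal{C}}(z) = g(z) + \frac{h(z)}{(1-z/\rho)^{\alpha}}, \] where $\alpha\notin -\mathbb{N}$ (i.e. $\alpha\notin\{0,-1,-2,\dots\}$) and both $g$ and $h$ are analytic on the cut closed disk $\overline{D}(0,\rho)\setminus \mathbb{R}^{\le 0}$. Then the number of objects of $\mathcal{C}$ of size at most $x$ satisfies, as $x\to\infty$ through the reals, \[ |\mathcal{C}_{\le x}| = [z^{\le x}]f_{\mathcal{C}}(z) \sim \frac{h(\rho)}{\log(1/\rho)\,\Gamma(\alpha)}\,\rho^{-x}\,x^{\alpha-1}. \]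
   Context: A combinatorial class $\mathcal{C}$ is a set of objects, each with a size $|c|\in\mathbb{R}^{\ge 0}$, such that the set $\Lambda_{\mathcal{C}}$ of sizes occurring has no finite accumulation point in $\mathbb{R}$ and for each $\lambda$ there are only finitely many objects of size $\lambda$. The class is rational if there is $\omega>0$ with $\Lambda_{\mathcal{C}}\subseteq \omega\mathbb{N}$, and irrational otherwise. Its irrational generating function is the generalised power series (Ribenboim series) $f_{\mathcal{C}}(z)=\sum_{c\in\mathcal{C}} z^{|c|}=\sum_{\lambda\in\Lambda_{\mathcal{C}}}|\mathcal{C}_\lambda| z^\lambda$, where $\mathcal{C}_\lambda$ is the set of objects of size $\lambda$; non-integer powers $z^\lambda$ and $(1-z/\rho)^{\alpha}$ use the principal branch, so $f_{\mathcal{C}}$ is analytic in $D(0,\rho)\setminus\mathbb{R}^{\le 0}$ with branch cut on the non-positive reals. For $x\ge 0$, $\mathcal{C}_{\le x}=\{c\in\mathcal{C}:|c|\le x\}$, and for a series $f(z)=\sum_\lambda c_\lambda z^\lambda$, $[z^{\le x}]f(z)=\sum_{\lambda\le x}c_\lambda$. The Dirichlet generating function of $\mathcal{C}$ is $F_{\mathcal{C}}(s)=\sum_{c\in\mathcal{C}}e^{-|c|s}$ (obtained by substituting $z=e^{-s}$ termwise); if $f_{\mathcal{C}}$ has radius of convergence $\rho$ then $F_{\mathcal{C}}$ converges in the half-plane $\operatorname{Re}s>\log(1/\rho)$, and the line $\operatorname{Re}s=\log(1/\rho)$ is its line of convergence. A singularity on this line is a point of the line to a neighbourhood of which $F_{\mathcal{C}}$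 cannot be analytically continued. An irrational class whose irrational generating function has radius of convergence $\rho\in(0,1)$ is called primitive if $\log(1/\rho)$ is the unique singularity of its Dirichlet generating function on its line of convergence.
   Formalization: The asymptotic equivalence is stated only when h(ρ) ≠ 0 (if h(ρ) = 0 the right-hand side is identically zero and the claim fails); without that proviso, |C_{≤x}| / (ρ^{-x} x^{α-1}) → h(ρ)/(log(1/ρ) Γ(α)) is proved instead. *)

theory Defs
  imports "HOL-Complex_Analysis.Complex_Analysis" "HOL-Library.Landau_Symbols"
begin

text \<open>
  A series \<open>\<Sum>l. c l z\<^sup>l\<close> is represented by its coefficient family \<open>c :: real \<Rightarrow> complex\<close>.
  Powers are taken with \<^const>\<open>powr\<close>, i.e. with the principal branch of the logarithm.
  Since \<open>0 powr 0 = 0\<close>, evaluation at \<open>z = 0\<close> drops the constant term; \<open>z = 0\<close> lies on the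
  branch cut and is not used.
\<close>

definition gps_support :: "(real \<Rightarrow> complex) \<Rightarrow> real set" where
  "gps_support c = {l. c l \<noteq> 0}"

definition gps_eval :: "(real \<Rightarrow> complex) \<Rightarrow> complex \<Rightarrow> complex" where
  "gps_eval c z = (\<Sum>\<^sub>\<infinity>l\<in>gps_support c. c l * z powr of_real l)"

text \<open>For real \<open>l\<close> one has \<open>\<bar>z\<^sup>l\<bar> = \<bar>z\<bar>\<^sup>l\<close>, so absolute convergence at \<open>z\<close> depends only on
  the modulus of \<open>z\<close>.\<close>

definition gps_radius :: "(real \<Rightarrow> complex) \<Rightarrow> ereal" where
  "gps_radius c =
     Sup {ereal r |r. 0 \<le> r \<and> (\<lambda>l. norm (c l) * r powr l) summable_on gps_support c}"

text \<open>The operator \<open>[z\<^sup>\<le>\<^sup>x]\<close>; it is meaningful when the support is finite below every bound.\<close>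

definition gps_coeff_upto :: "(real \<Rightarrow> complex) \<Rightarrow> real \<Rightarrow> complex" where
  "gps_coeff_upto c x = (\<Sum>l | l \<in> gps_support c \<and> l \<le> x. c l)"

text \<open>A class is a set \<open>C\<close> of objects together with a size function \<open>sz\<close>.\<close>

definition combinatorial_class :: "'a set \<Rightarrow> ('a \<Rightarrow> real) \<Rightarrow> bool" where
  "combinatorial_class C sz \<longleftrightarrow>
     (\<forall>c\<in>C. 0 \<le> sz c) \<and>
     (\<forall>x. \<not> x islimpt (sz ` C)) \<and>
     (\<forall>l. finite {c \<in> C. sz c = l})"

definition rational_class :: "'a set \<Rightarrow> ('a \<Rightarrow> real) \<Rightarrow> bool" where
  "rational_class C sz \<longleftrightarrow> (\<exists>\<omega>>0. sz ` C \<subseteq> range (\<lambda>n::nat. \<omega> * of_nat n))"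

definition irrational_class :: "'a set \<Rightarrow> ('a \<Rightarrow> real) \<Rightarrow> bool" where
  "irrational_class C sz \<longleftrightarrow> combinatorial_class C sz \<and> \<not> rational_class C sz"

definition irrational_gf :: "'a set \<Rightarrow> ('a \<Rightarrow> real) \<Rightarrow> real \<Rightarrow> complex" where
  "irrational_gf C sz = (\<lambda>l. of_nat (card {c \<in> C. sz c = l}))"

definition dirichlet_gf :: "'a set \<Rightarrow> ('a \<Rightarrow> real) \<Rightarrow> complex \<Rightarrow> complex" where
  "dirichlet_gf C sz s = (\<Sum>\<^sub>\<infinity>c\<in>C. exp (- of_real (sz c) * s))"

text \<open>Singularities, on the line \<open>Re s = a\<close>, of a function \<open>F\<close> given on the half-plane
  \<open>Re s > a\<close>. Values of \<open>F\<close> outside that half-plane are irrelevant.\<close>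

definition line_singularities :: "(complex \<Rightarrow> complex) \<Rightarrow> real \<Rightarrow> complex set" where
  "line_singularities F a =
     {s. Re s = a \<and>
         \<not> (\<exists>r>0. \<exists>G. G holomorphic_on ball s r \<and> (\<forall>w\<in>ball s r. Re w > a \<longrightarrow> G w = F w))}"

definition primitive_class :: "'a set \<Rightarrow> ('a \<Rightarrow> real) \<Rightarrow> bool" where
  "primitive_class C sz \<longleftrightarrow>
     irrational_class C sz \<and>
     (\<exists>\<rho>. gps_radius (irrational_gf C sz) = ereal \<rho> \<and> 0 < \<rho> \<and> \<rho> < 1 \<and>
          line_singularities (dirichlet_gf C sz) (ln (1 / \<rho>)) = {of_real (ln (1 / \<rho>))})"

end

theory Submission
  imports Defs "HOL-Probability.Sinc_Integral" "HOL-Real_Asymp.Real_Asymp"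
begin

text \<open>
  Let \<open>a = ln (1 / \<rho>)\<close> and let \<open>N\<close> be the counting function of the class. Its Laplace transform is
  the Dirichlet generating function divided by \<open>s\<close>, so it continues across the line \<open>Re s = a\<close>
  except at \<open>a\<close>, where it behaves like a constant times \<open>(s - a) powr (- \<alpha>)\<close>. Replacing \<open>N t\<close> by
  \<open>t ^ k * N t\<close>, i.e. differentiating the transform \<open>k\<close> times, raises the exponent to
  \<open>\<beta> = \<alpha> + k\<close> with \<open>Re \<beta> > 1\<close>.

  The Tauberian step is a variant of the Wiener--Ikehara argument. Put
  \<open>B t = exp (- a t) * t ^ k * N t\<close> and average \<open>B t * exp (- t / x)\<close> around \<open>t = x\<close> against a
  Fejer kernel. On the Fourier side the difference between \<open>B\<close> and its model
  \<open>L * t powr (\<beta> - 1)\<close> becomes an integral over a bounded segment of the line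
  \<open>Re s = a + 1 / x\<close>. There the transform of the difference has size at most
  \<open>x powr (Re \<beta> - 1)\<close> and stays bounded at every point other than \<open>a\<close>, so by dominated convergence the integral is
  \<open>o(x powr (Re \<beta> - 1))\<close>: because the damping depends on \<open>x\<close>, neither the Riemann--Lebesgue lemma
  nor an asymptotic expansion at \<open>a\<close> is needed. Monotonicity of \<open>N\<close> then removes the averaging.
  The phase \<open>x powr (\<i> * Im \<beta>)\<close> is unimodular, so non-real \<open>\<alpha>\<close> and \<open>h \<rho> = 0\<close> need no
  separate treatment.
\<close>

subsection \<open>Laplace transforms\<close>

definition laplace :: "(real \<Rightarrow> complex) \<Rightarrow> complex \<Rightarrow> complex" where
  "laplace f s = (\<integral>t. f t * exp (- (s * of_real t)) \<partial>lborel)"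

text \<open>One-sidedness is part of this predicate, so \<open>laplace\<close> can integrate over
  the whole line. Convergence is absolute and only strictly to the right of \<open>a\<close>; the
  line \<open>Re s = a\<close> itself is reached later through local continuations.\<close>

definition laplace_conv :: "(real \<Rightarrow> complex) \<Rightarrow> real \<Rightarrow> bool" where
  "laplace_conv f a \<longleftrightarrow> f \<in> borel_measurable borel \<and> (\<forall>t<0. f t = 0) \<and>
     (\<forall>\<sigma>>a. integrable lborel (\<lambda>t. norm (f t) * exp (- (\<sigma> * t))))"

lemma laplace_integrable:
  assumes "laplace_conv f a" "Re s > a"
  shows "integrable lborel (\<lambda>t. f t * exp (- (s * of_real t)))"
proof -
  have [measurable]: "f \<in> borel_measurable borel"
    using assms by (simp add: laplace_conv_def)
  have "integrable lborel (\<lambda>t. norm (f t) * exp (- (Re s * t)))"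
    using assms by (simp add: laplace_conv_def)
  then show ?thesis
    by (rule Bochner_Integration.integrable_bound) (auto simp: norm_mult)
qed

text \<open>The factor \<open>t\<close> is paid for with half of the gap between
  \<open>\<sigma>\<close> and \<open>a\<close>: \<open>t \<le> exp (\<delta> * t) / \<delta>\<close>
  for \<open>t \<ge> 0\<close>.\<close>

lemma laplace_conv_times:
  assumes "laplace_conv f a"
  shows "laplace_conv (\<lambda>t. of_real t * f t) a"
proof -
  have [measurable]: "f \<in> borel_measurable borel" and 0: "\<And>t. t < 0 \<Longrightarrow> f t = 0"
    using assms by (auto simp: laplace_conv_def)
  have "integrable lborel (\<lambda>t. norm (of_real t * f t) * exp (- (\<sigma> * t)))" if "\<sigma> > a" for \<sigma>
  proof -
    define \<delta> where "\<delta> = (\<sigma> - a) / 2"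
    have \<delta>: "\<delta> > 0" "\<sigma> - \<delta> > a" using that by (auto simp: \<delta>_def field_simps)
    have "integrable lborel (\<lambda>t. (1 / \<delta>) * (norm (f t) * exp (- ((\<sigma> - \<delta>) * t))))"
      using assms \<delta> by (auto simp: laplace_conv_def)
    then show ?thesis
    proof (rule Bochner_Integration.integrable_bound)
      show "AE t in lborel. norm (norm (of_real t * f t) * exp (- (\<sigma> * t)))
        \<le> norm (1 / \<delta> * (norm (f t) * exp (- ((\<sigma> - \<delta>) * t))))"
      proof (intro AE_I2)
        fix t :: real
        show "norm (norm (of_real t * f t) * exp (- (\<sigma> * t)))
          \<le> norm (1 / \<delta> * (norm (f t) * exp (- ((\<sigma> - \<delta>) * t))))"
        proof (cases "t < 0")
          case False
          have "\<delta> * t \<le> exp (\<delta> * t)" using exp_ge_add_one_self[of "\<delta> * t"] by linarith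
          then have "t \<le> exp (\<delta> * t) / \<delta>" using \<delta> by (simp add: field_simps)
          then have "t * (norm (f t) * exp (- (\<sigma> * t))) \<le> exp (\<delta> * t) / \<delta> * (norm (f t) * exp (- (\<sigma> * t)))"
            by (rule mult_right_mono) auto
          also have "\<dots> = 1 / \<delta> * (norm (f t) * (exp (\<delta> * t) * exp (- (\<sigma> * t))))" by simp
          also have "exp (\<delta> * t) * exp (- (\<sigma> * t)) = exp (- ((\<sigma> - \<delta>) * t))"
            by (simp flip: exp_add add: algebra_simps)
          finally show ?thesis using False \<delta> by (simp add: norm_mult abs_mult)
        qed (simp add: 0)
      qed
    qed auto
  qed
  then show ?thesis using 0 by (simp add: laplace_conv_def)
qed

text \<open>Differentiation under the integral sign, by dominated convergence along sequences
  tending to \<open>0\<close>. The difference quotients are dominated by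
  \<open>norm (of_real t * f t) * exp (- ((Re s - \<delta>) * t))\<close>, which is integrable by
  \<open>laplace_conv_times\<close>.\<close>

lemma laplace_has_derivative:
  assumes f: "laplace_conv f a" and s: "Re s > a"
  shows "(laplace f has_field_derivative - laplace (\<lambda>t. of_real t * f t) s) (at s)"
  unfolding has_field_derivative_def DERIV_def has_derivative_at2[symmetric]
  unfolding has_field_derivative_def[symmetric] DERIV_def tendsto_at_iff_sequentially
proof (intro allI impI)
  fix X :: "nat \<Rightarrow> complex" assume X0: "\<forall>i. X i \<in> UNIV - {0}" and X: "X \<longlonglongrightarrow> 0"
  have [measurable]: "f \<in> borel_measurable borel" and 0: "\<And>t. t < 0 \<Longrightarrow> f t = 0"
    using f by (auto simp: laplace_conv_def)
  define \<delta> where "\<delta> = (Re s - a) / 2"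
  have \<delta>: "\<delta> > 0" "Re s - \<delta> > a" using s by (auto simp: \<delta>_def field_simps)
  from X \<delta>(1) have "\<forall>\<^sub>F n in sequentially. norm (X n) < \<delta>"
    using order_tendstoD(2) tendsto_norm_zero by blast
  then obtain N where N: "\<And>n. n \<ge> N \<Longrightarrow> norm (X n) < \<delta>" by (auto simp: eventually_sequentially)
  \<comment> \<open>Dropping the first \<open>N\<close> terms puts the whole sequence within
    \<open>\<delta>\<close> of \<open>0\<close>, so one dominating function serves every index.
    \<open>LIMSEQ_offset\<close> restores the dropped terms at the end.\<close>
  define Y where "Y = (\<lambda>n. X (n + N))"
  have Y: "Y \<longlonglongrightarrow> 0" "\<And>n. norm (Y n) < \<delta>" "\<And>n. Y n \<noteq> 0"
    using LIMSEQ_ignore_initial_segment[OF X, of N] X0 N by (auto simp: Y_def)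
  have "(\<lambda>n. \<integral>t. (f t * exp (- ((s + Y n) * of_real t)) - f t * exp (- (s * of_real t))) / Y n \<partial>lborel)
     \<longlonglongrightarrow> (\<integral>t. - (of_real t * f t * exp (- (s * of_real t))) \<partial>lborel)"
  proof (rule integral_dominated_convergence[where w="\<lambda>t. norm (of_real t * f t) * exp (- ((Re s - \<delta>) * t))"])
    show "integrable lborel (\<lambda>t. norm (of_real t * f t) * exp (- ((Re s - \<delta>) * t)))"
      using laplace_conv_times[OF f] \<delta> by (simp add: laplace_conv_def)
    show "AE t in lborel. (\<lambda>n. (f t * exp (- ((s + Y n) * of_real t)) - f t * exp (- (s * of_real t))) / Y n)
       \<longlonglongrightarrow> - (of_real t * f t * exp (- (s * of_real t)))"
    proof (intro AE_I2)
      fix t :: real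
      have "((\<lambda>s. f t * exp (- (s * of_real t))) has_field_derivative - (of_real t * f t * exp (- (s * of_real t)))) (at s)"
        by (auto intro!: derivative_eq_intros)
      then have "((\<lambda>h. (f t * exp (- ((s + h) * of_real t)) - f t * exp (- (s * of_real t))) / h) \<longlongrightarrow> - (of_real t * f t * exp (- (s * of_real t)))) (at 0)"
        by (simp add: DERIV_def)
      then show "(\<lambda>n. (f t * exp (- ((s + Y n) * of_real t)) - f t * exp (- (s * of_real t))) / Y n)
       \<longlonglongrightarrow> - (of_real t * f t * exp (- (s * of_real t)))"
        using Y unfolding tendsto_at_iff_sequentially comp_def by auto
    qed
    show "AE t in lborel. norm ((f t * exp (- ((s + Y n) * of_real t)) - f t * exp (- (s * of_real t))) / Y n)
      \<le> norm (of_real t * f t) * exp (- ((Re s - \<delta>) * t))" for n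
    proof (intro AE_I2)
      fix t :: real
      show "norm ((f t * exp (- ((s + Y n) * of_real t)) - f t * exp (- (s * of_real t))) / Y n)
      \<le> norm (of_real t * f t) * exp (- ((Re s - \<delta>) * t))"
      proof (cases "t < 0")
        case False
        \<comment> \<open>Taylor remainder of first order; its exponential factor lowers the decay
          rate from \<open>Re s\<close> to \<open>Re s - \<delta>\<close>.\<close>
        have "norm (exp (- (Y n * of_real t)) - 1) \<le> exp \<bar>Re (- (Y n * of_real t))\<bar> * norm (Y n * of_real t)"
          using Taylor_exp[of "- (Y n * of_real t)" 0] by simp
        also have "\<dots> \<le> exp (\<delta> * t) * (norm (Y n) * t)"
        proof -
          have "\<bar>Re (Y n)\<bar> \<le> \<delta>" using abs_Re_le_cmod[of "Y n"] Y(2)[of n] by linarith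
          then have "\<bar>Re (Y n)\<bar> * t \<le> \<delta> * t" using False by (intro mult_right_mono) auto
          then show ?thesis using False by (auto simp: norm_mult abs_mult intro!: mult_right_mono)
        qed
        finally have *: "norm (exp (- (Y n * of_real t)) - 1) / norm (Y n) \<le> exp (\<delta> * t) * t"
          using Y(3)[of n] by (simp add: field_simps)
        have "(f t * exp (- ((s + Y n) * of_real t)) - f t * exp (- (s * of_real t))) / Y n
          = f t * exp (- (s * of_real t)) * ((exp (- (Y n * of_real t)) - 1) / Y n)"
        proof -
          have "exp (- ((s + Y n) * of_real t)) = exp (- (s * of_real t)) * exp (- (Y n * of_real t))"
            by (simp flip: exp_add add: algebra_simps)
          then show ?thesis by (simp add: algebra_simps diff_divide_distrib)
        qed
        then have "norm ((f t * exp (- ((s + Y n) * of_real t)) - f t * exp (- (s * of_real t))) / Y n)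
          = norm (f t) * exp (- (Re s * t)) * (norm (exp (- (Y n * of_real t)) - 1) / norm (Y n))"
          by (simp only: norm_mult norm_divide) simp
        also have "\<dots> \<le> norm (f t) * exp (- (Re s * t)) * (exp (\<delta> * t) * t)"
          using * by (intro mult_left_mono) auto
        also have "\<dots> = norm (of_real t * f t) * (exp (- (Re s * t)) * exp (\<delta> * t))"
          using False by (simp add: norm_mult)
        also have "exp (- (Re s * t)) * exp (\<delta> * t) = exp (- ((Re s - \<delta>) * t))"
          by (simp flip: exp_add add: algebra_simps)
        finally show ?thesis .
      qed (simp add: 0)
    qed
  qed auto
  moreover have "(\<integral>t. (f t * exp (- ((s + Y n) * of_real t)) - f t * exp (- (s * of_real t))) / Y n \<partial>lborel)
      = (laplace f (s + Y n) - laplace f s) / Y n" for n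
  proof -
    have "Re (s + Y n) > a"
      using abs_Re_le_cmod[of "Y n"] Y(2)[of n] \<delta> by simp
    then show ?thesis
      using laplace_integrable[OF f] s by (simp add: laplace_def)
  qed
  moreover have "(\<integral>t. - (of_real t * f t * exp (- (s * of_real t))) \<partial>lborel) = - laplace (\<lambda>t. of_real t * f t) s"
    by (simp add: laplace_def)
  ultimately have "(\<lambda>n. (laplace f (s + X (n + N)) - laplace f s) / X (n + N)) \<longlonglongrightarrow> - laplace (\<lambda>t. of_real t * f t) s"
    by (simp only: Y_def)
  then show "((\<lambda>h. (laplace f (s + h) - laplace f s) / h) \<circ> X) \<longlonglongrightarrow> - laplace (\<lambda>t. of_real t * f t) s"
    unfolding comp_def by (rule LIMSEQ_offset)
qed

lemma laplace_holomorphic: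
  assumes "laplace_conv f a"
  shows "laplace f holomorphic_on {s. Re s > a}"
  using laplace_has_derivative[OF assms] by (auto simp: holomorphic_on_open open_halfspace_Re_gt)

section \<open>Power densities and the Gamma integral\<close>

definition powr_density :: "complex \<Rightarrow> real \<Rightarrow> complex" where
  "powr_density \<beta> t = (if t > 0 then of_real t powr (\<beta> - 1) else 0)"

text \<open>Euler's integral for \<open>Gamma\<close> after the substitution
  \<open>t \<mapsto> x * t\<close>. For positive real \<open>x\<close> the complex power of the
  product splits without a branch correction.\<close>

lemma laplace_powr_density_real:
  assumes "Re \<beta> > 0" "x > 0"
  shows "integrable lborel (\<lambda>t. powr_density \<beta> t * exp (- (of_real x * of_real t)))"
    and "laplace (powr_density \<beta>) (of_real x) = Gamma \<beta> * of_real x powr (- \<beta>)"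
proof -
  have m[measurable]: "powr_density \<beta> \<in> borel_measurable borel"
    unfolding powr_density_def powr_def by measurable
  let ?g = "\<lambda>t. powr_density \<beta> t * exp (- of_real t)"
  have eq: "indicator {0<..} t *\<^sub>R (complex_of_real t powr (\<beta> - 1) / of_real (exp t)) = ?g t" for t
    by (auto simp: powr_density_def indicator_def exp_minus field_simps exp_of_real)
  have ai: "(\<lambda>t. complex_of_real t powr (\<beta> - 1) / of_real (exp t)) absolutely_integrable_on {0<..}"
    using absolutely_integrable_Gamma_integral'[OF assms(1)] .
  have i1: "integrable lborel ?g"
    using ai unfolding set_integrable_def eq
    by (subst (asm) integrable_completion) auto
  have "((\<lambda>t. complex_of_real t powr (\<beta> - 1) / of_real (exp t)) has_integral Gamma \<beta>) {0<..}"
    using Gamma_integral_complex'[OF assms(1)] .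
  then have "(LINT t:{0<..}|lebesgue. complex_of_real t powr (\<beta> - 1) / of_real (exp t)) = Gamma \<beta>"
    using ai by (simp add: set_lebesgue_integral_eq_integral integral_unique)
  then have I: "integral\<^sup>L lborel ?g = Gamma \<beta>"
    unfolding set_lebesgue_integral_def eq by (subst (asm) integral_completion) auto
  have sc: "?g (0 + x * t) = of_real x powr (\<beta> - 1) * (powr_density \<beta> t * exp (- (of_real x * of_real t)))" for t
    using assms(2) by (auto simp: powr_density_def powr_times_real zero_less_mult_iff)
  have "integrable lborel (\<lambda>t. ?g (0 + x * t))"
    by (rule lborel_integrable_real_affine[OF i1]) (use assms in auto)
  then have "integrable lborel (\<lambda>t. of_real x powr (\<beta> - 1) * (powr_density \<beta> t * exp (- (complex_of_real x * of_real t))))"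
    unfolding sc .
  then have "integrable lborel (\<lambda>t. inverse (of_real x powr (\<beta> - 1)) *
      (of_real x powr (\<beta> - 1) * (powr_density \<beta> t * exp (- (complex_of_real x * of_real t)))))"
    by (rule integrable_mult_right)
  then show "integrable lborel (\<lambda>t. powr_density \<beta> t * exp (- (of_real x * of_real t)))"
    using assms(2) by (simp add: mult.assoc[symmetric])
  have "Gamma \<beta> = of_real x * (of_real x powr (\<beta> - 1) * laplace (powr_density \<beta>) (of_real x))"
    using lborel_integral_real_affine[of x ?g 0] assms(2) unfolding sc I
    by (simp add: laplace_def scaleR_conv_of_real)
  also have "of_real x * (of_real x powr (\<beta> - 1) * laplace (powr_density \<beta>) (of_real x)) =
     of_real x powr \<beta> * laplace (powr_density \<beta>) (of_real x)"
    using assms(2) by (simp add: powr_diff)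
  finally show "laplace (powr_density \<beta>) (of_real x) = Gamma \<beta> * of_real x powr (- \<beta>)"
    using assms(2) by (simp add: powr_minus)
qed

lemma laplace_conv_powr_density:
  assumes "Re \<beta> > 0"
  shows "laplace_conv (powr_density \<beta>) 0"
proof -
  have m[measurable]: "powr_density \<beta> \<in> borel_measurable borel"
    unfolding powr_density_def powr_def by measurable
  have "integrable lborel (\<lambda>t. norm (powr_density \<beta> t) * exp (- (x * t)))" if "x > 0" for x
    using integrable_norm[OF laplace_powr_density_real(1)[OF assms that]] by (simp add: norm_mult)
  moreover have "powr_density \<beta> t = 0" if "t < 0" for t
    using that by (simp add: powr_density_def)
  ultimately show ?thesis using m by (simp add: laplace_conv_def)
qed

text \<open>Identity theorem: both sides are holomorphic on the right half-plane and agree on the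
  real segment from \<open>0\<close> to \<open>2\<close>, which accumulates at
  \<open>1\<close>.\<close>

lemma laplace_powr_density:
  assumes "Re \<beta> > 0" "Re s > 0"
  shows "laplace (powr_density \<beta>) s = Gamma \<beta> * s powr (- \<beta>)"
proof -
  let ?U = "{s::complex. Re s > 0}"
  have "laplace (powr_density \<beta>) s - Gamma \<beta> * s powr (- \<beta>) = 0"
  proof (rule analytic_continuation[where f="\<lambda>s. laplace (powr_density \<beta>) s - Gamma \<beta> * s powr (- \<beta>)" and S="?U" and U="of_real ` {0<..<2}" and \<xi>=1])
    show "(\<lambda>s. laplace (powr_density \<beta>) s - Gamma \<beta> * s powr (- \<beta>)) holomorphic_on ?U"
      by (intro holomorphic_intros laplace_holomorphic laplace_conv_powr_density assms)
         (auto simp: complex_nonpos_Reals_iff)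
    show "connected ?U" by (intro convex_connected convex_halfspace_Re_gt)
    show "(1::complex) islimpt of_real ` {0<..<2}"
    proof (rule islimptI)
      fix T :: "complex set" assume T: "1 \<in> T" "open T"
      then obtain e where e: "e > 0" "ball 1 e \<subseteq> T" by (auto simp: open_contains_ball)
      define d where "d = 1 + min e 1 / 2"
      have "dist 1 (complex_of_real d) = \<bar>1 - d\<bar>"
        using dist_of_real[of 1 d, where 'a=complex] by (simp add: dist_real_def)
      then have "of_real d \<in> T" using e by (intro subsetD[OF e(2)]) (auto simp: d_def)
      moreover have "d \<in> {0<..<2}" "d \<noteq> 1" using e by (auto simp: d_def)
      ultimately show "\<exists>y\<in>complex_of_real ` {0<..<2}. y \<in> T \<and> y \<noteq> 1"
        by (intro bexI[of _ "of_real d"]) auto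
    qed
    show "laplace (powr_density \<beta>) z - Gamma \<beta> * z powr (- \<beta>) = 0" if "z \<in> of_real ` {0<..<2}" for z
      using that laplace_powr_density_real(2)[OF assms(1)] by auto
  qed (use assms(2) in \<open>auto simp: open_halfspace_Re_gt\<close>)
  then show ?thesis by simp
qed

subsection \<open>The Fejer kernel\<close>

definition tri :: "real \<Rightarrow> real" where "tri y = max 0 (1 - \<bar>y\<bar>)"

text \<open>This is the square of \<open>sin (u / 2) / (u / 2)\<close>, the Fourier transform of the
  triangle \<open>tri\<close>. The value at \<open>0\<close> is the limit there.\<close>

definition fejer :: "real \<Rightarrow> real" where
  "fejer u = (if u = 0 then 1 else 2 * (1 - cos u) / u\<^sup>2)"

lemma tri_nonneg: "0 \<le> tri y" and tri_le_1: "tri y \<le> 1" and tri_eq_0: "\<bar>y\<bar> \<ge> 1 \<Longrightarrow> tri y = 0"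
  by (auto simp: tri_def)

lemma tri_measurable [measurable]: "tri \<in> borel_measurable borel"
  unfolding tri_def by measurable

lemma fejer_measurable [measurable]: "fejer \<in> borel_measurable borel"
  unfolding fejer_def by measurable

lemma tri_integrable: "integrable lborel tri"
proof -
  have "integrable lborel (indicator {-1..1::real} :: real \<Rightarrow> real)" by simp
  then show ?thesis
    by (rule Bochner_Integration.integrable_bound) (auto simp: tri_def indicator_def)
qed

text \<open>Integration by parts, packed into the antiderivative \<open>F\<close>. With
  \<open>c\<close> complex, the cases \<open>\<i> * u\<close> and \<open>- \<i> * u\<close> give the
  two halves of the transform of \<open>tri\<close>.\<close>

lemma tri_exp_has_integral_half:
  fixes c :: complex
  assumes "c \<noteq> 0"
  shows "((\<lambda>y. of_real (1 - y) * exp (c * of_real y)) has_integral (exp c - 1 - c) / c\<^sup>2) {0..1}"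
proof -
  define F where "F y = ((1 - y) / c + 1 / c\<^sup>2) * exp (c * y)" for y
  have "((\<lambda>y. of_real (1 - y) * exp (c * of_real y)) has_integral F (of_real 1) - F (of_real 0)) {0..1}"
  proof (rule fundamental_theorem_of_calculus)
    fix y :: real
    have "(F has_field_derivative (1 - of_real y) * exp (c * of_real y)) (at (of_real y))"
      unfolding F_def using assms
      by (auto intro!: derivative_eq_intros simp: field_simps power2_eq_square)
    then show "((\<lambda>y. F (of_real y)) has_vector_derivative of_real (1 - y) * exp (c * of_real y)) (at y within {0..1})"
      using has_vector_derivative_real_field has_vector_derivative_at_within by fastforce
  qed simp
  also have "F (of_real 1) - F (of_real 0) = (exp c - 1 - c) / c\<^sup>2"
    using assms by (simp add: F_def field_simps power2_eq_square)
  finally show ?thesis .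
qed

text \<open>The integral is split at \<open>0\<close>. The linear terms of the two halves cancel and
  leave \<open>(exp c + exp (-c) - 2) / c\<^sup>2\<close>; the case \<open>u = 0\<close> is the area
  of the triangle.\<close>

lemma fejer_fourier: "(\<integral>y. of_real (tri y) * exp (\<i> * of_real (u * y)) \<partial>lborel) = of_real (fejer u)"
proof -
  define g where "g y = of_real (1 - \<bar>y\<bar>) * exp (\<i> * of_real (u * y))" for y :: real
  have ci: "set_integrable lborel {-1..1} g"
    unfolding g_def by (intro borel_integrable_atLeastAtMost' continuous_intros)
  have "(\<integral>y. of_real (tri y) * exp (\<i> * of_real (u * y)) \<partial>lborel) = (LINT y:{-1..1}|lborel. g y)"
    unfolding set_lebesgue_integral_def
    by (intro Bochner_Integration.integral_cong) (auto simp: g_def tri_def indicator_def)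
  also have "\<dots> = integral {-1..1} g"
    by (rule set_borel_integral_eq_integral(2)[OF ci])
  also have "(g has_integral of_real (fejer u)) {-1..1}"
  proof (cases "u = 0")
    case False
    define c where "c = \<i> * of_real u"
    have c: "c \<noteq> 0" "c\<^sup>2 = - of_real (u\<^sup>2)" using False by (auto simp: c_def power_mult_distrib)
    have 1: "(g has_integral (exp c - 1 - c) / c\<^sup>2) {0..1}"
      using tri_exp_has_integral_half[OF c(1)]
      by (rule has_integral_eq[rotated]) (auto simp: g_def c_def mult_ac)
    have "((\<lambda>y. of_real (1 - y) * exp ((-c) * of_real y)) has_integral (exp (-c) - 1 - (-c)) / (-c)\<^sup>2) {0..1}"
      using tri_exp_has_integral_half[of "-c"] c by simp
    then have "((\<lambda>y. of_real (1 - (-y)) * exp ((-c) * of_real (-y))) has_integral (exp (-c) - 1 - (-c)) / (-c)\<^sup>2) {-1..0}"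
      using has_integral_reflect_real[of "\<lambda>y. of_real (1 - y) * exp ((-c) * of_real y)" _ 1 0] by simp
    moreover have "(exp (-c) - 1 - (-c)) / (-c)\<^sup>2 = (exp (-c) - 1 + c) / c\<^sup>2" by simp
    ultimately have "((\<lambda>y. of_real (1 - (-y)) * exp ((-c) * of_real (-y))) has_integral (exp (-c) - 1 + c) / c\<^sup>2) {-1..0}"
      by (simp only:)
    then have 2: "(g has_integral (exp (-c) - 1 + c) / c\<^sup>2) {-1..0}"
      by (rule has_integral_eq[rotated]) (auto simp: g_def c_def mult_ac)
    have "(g has_integral (exp (-c) - 1 + c) / c\<^sup>2 + (exp c - 1 - c) / c\<^sup>2) {-1..1}"
      by (rule has_integral_combine[OF _ _ 2 1]) auto
    also have "(exp (-c) - 1 + c) / c\<^sup>2 + (exp c - 1 - c) / c\<^sup>2 = (exp c + exp (-c) - 2) / c\<^sup>2"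
      by (simp add: add_divide_distrib diff_divide_distrib)
    also have "exp c + exp (-c) = 2 * cos (of_real u)"
      by (simp add: c_def cos_exp_eq)
    also have "(2 * cos (of_real u) - 2) / c\<^sup>2 = complex_of_real (fejer u)"
      using False unfolding c(2) by (simp add: fejer_def field_simps flip: cos_of_real)
    finally show ?thesis .
  next
    case True
    have "((\<lambda>y. 1 - y) has_integral ((1 - 1\<^sup>2/2) - (0 - 0\<^sup>2/2))) {0..1::real}"
      by (rule fundamental_theorem_of_calculus)
        (auto intro!: derivative_eq_intros simp: has_real_derivative_iff_has_vector_derivative[symmetric])
    then have 1: "((\<lambda>y. 1 - \<bar>y\<bar>) has_integral 1/2) {0..1::real}"
      by (subst has_integral_cong[where g="\<lambda>y. 1 - y"]) auto
    have "((\<lambda>y. 1 + y) has_integral ((0 + 0\<^sup>2/2) - (-1 + (-1)\<^sup>2/2))) {-1..0::real}"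
      by (rule fundamental_theorem_of_calculus)
        (auto intro!: derivative_eq_intros simp: has_real_derivative_iff_has_vector_derivative[symmetric])
    then have 2: "((\<lambda>y. 1 - \<bar>y\<bar>) has_integral 1/2) {-1..0::real}"
      by (subst has_integral_cong[where g="\<lambda>y. 1 + y"]) auto
    have "((\<lambda>y. 1 - \<bar>y\<bar>) has_integral 1/2 + 1/2) {-1..1::real}"
      by (rule has_integral_combine[OF _ _ 2 1]) auto
    then have "((\<lambda>y. complex_of_real (1 - \<bar>y\<bar>)) has_integral of_real 1) {-1..1}"
      by (intro has_integral_of_real) simp
    then show ?thesis by (simp add: g_def[abs_def] True fejer_def)
  qed
  then have "integral {-1..1} g = of_real (fejer u)" by (rule integral_unique)
  finally show ?thesis .
qed

lemma fejer_nonneg: "0 \<le> fejer u"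
  by (simp add: fejer_def)

text \<open>The numerator \<open>2 * (1 - cos u)\<close> is at most \<open>u\<^sup>2\<close> and at
  most \<open>4\<close>. Using the first bound against \<open>1\<close> and the second against
  \<open>u\<^sup>2\<close> in the product with \<open>1 + u\<^sup>2\<close> yields the constant
  \<open>5\<close>.\<close>

lemma fejer_le: "fejer u \<le> 5 * inverse (1 + u\<^sup>2)"
proof (cases "u = 0")
  case False
  have "cos u = 1 - 2 * (sin (u / 2))\<^sup>2" using cos_double_sin[of "u/2"] by simp
  moreover have "(sin (u / 2))\<^sup>2 \<le> (u / 2)\<^sup>2"
    using abs_sin_x_le_abs_x[of "u/2"] by (simp only: abs_le_square_iff)
  ultimately have "2 * (1 - cos u) \<le> u\<^sup>2" by (simp add: power_divide)
  moreover have "2 * (1 - v) \<le> 4" if "-1 \<le> v" for v :: real using that by simp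
  from this[OF cos_ge_minus_one[of u]] have "2 * (1 - cos u) \<le> 4" .
  moreover have "0 \<le> 2 * (1 - cos u)" by simp
  ultimately have "2 * (1 - cos u) * (1 + u\<^sup>2) \<le> 5 * u\<^sup>2"
    using mult_right_mono[of "2 * (1 - cos u)" 4 "u\<^sup>2"] by (simp add: algebra_simps)
  moreover have "0 < u\<^sup>2" "0 < 1 + u\<^sup>2" using False by (auto intro: add_pos_nonneg)
  ultimately show ?thesis using False by (simp add: fejer_def field_simps)
qed (simp add: fejer_def)

lemma fejer_integrable: "integrable lborel fejer"
proof -
  have "integrable lborel (\<lambda>x::real. 5 * inverse (1 + x\<^sup>2))"
    using integrable_inverse_1_plus_square by (simp add: set_integrable_def)
  then show ?thesis
    by (rule Bochner_Integration.integrable_bound)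
       (use fejer_le fejer_nonneg in \<open>auto simp: abs_of_nonneg\<close>)
qed

section \<open>Mass and windows of the Fejer kernel\<close>

definition fejer_mass :: real where "fejer_mass = integral\<^sup>L lborel fejer"

lemma integrable_mult_fejer:
  fixes g :: "real \<Rightarrow> 'a :: {real_normed_field, banach, second_countable_topology}"
  assumes "integrable lborel g"
  shows "integrable lborel (\<lambda>t. g t * of_real (fejer (l * (x - t))))"
proof (rule Bochner_Integration.integrable_bound[OF integrable_mult_right[OF assms, of "of_real 5"]])
  have [measurable]: "g \<in> borel_measurable borel" using borel_measurable_integrable[OF assms] by simp
  show "(\<lambda>t. g t * of_real (fejer (l * (x - t)))) \<in> borel_measurable lborel" by measurable
  have "\<bar>fejer v\<bar> \<le> 5" for v
  proof -
    have "fejer v \<le> 5 * inverse (1 + v\<^sup>2)" by (rule fejer_le)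
    also have "inverse (1 + v\<^sup>2) \<le> inverse 1" by (intro le_imp_inverse_le) auto
    finally show ?thesis using fejer_nonneg[of v] by simp
  qed
  then show "AE t in lborel. norm (g t * of_real (fejer (l * (x - t)))) \<le> norm (of_real 5 * g t)"
    by (intro AE_I2) (auto simp: norm_mult mult.commute intro!: mult_left_mono)
qed

lemma fejer_window_integrable: "integrable lborel (\<lambda>u. indicator {-R..R} u * fejer u)"
  by (rule Bochner_Integration.integrable_bound[OF fejer_integrable]) (auto simp: indicator_def)

text \<open>A rectangle below the kernel suffices. On the interval from \<open>r / 2\<close> to
  \<open>r\<close> with \<open>r \<le> 1 < pi\<close> the cosine is decreasing, so the kernel is at
  least \<open>c\<close> there.\<close>

lemma fejer_window_pos:
  assumes "R > 0"
  shows "(\<integral>u. indicator {-R..R} u * fejer u \<partial>lborel) > 0"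
proof -
  define r where "r = min R 1"
  define c where "c = 2 * (1 - cos (r / 2)) / r\<^sup>2"
  have r: "r > 0" "r \<le> R" "r \<le> 1" using assms by (auto simp: r_def)
  have "cos (r / 2) < cos 0" using r pi_gt3 by (intro cos_monotone_0_pi) auto
  then have c: "c > 0" using r by (simp add: c_def)
  have "0 < c * (r / 2)" using c r by simp
  also have "c * (r / 2) = (\<integral>x. c * indicator {r/2..r} x \<partial>lborel)" using r by simp
  also have "\<dots> \<le> (\<integral>u. indicator {-R..R} u * fejer u \<partial>lborel)"
  proof (rule integral_mono[OF _ fejer_window_integrable])
    fix u :: real
    show "c * indicator {r/2..r} u \<le> indicator {-R..R} u * fejer u"
    proof (cases "u \<in> {r/2..r}")
      case True
      then have u: "u > 0" using r by auto
      have "cos u \<le> cos (r / 2)" using True r pi_gt3 by (intro cos_monotone_0_pi_le) auto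
      moreover have "u\<^sup>2 \<le> r\<^sup>2" using True u by (intro power_mono) auto
      ultimately have "c \<le> 2 * (1 - cos u) / u\<^sup>2"
        unfolding c_def using u by (intro frac_le) auto
      moreover have "fejer u = 2 * (1 - cos u) / u\<^sup>2" using u by (simp add: fejer_def)
      ultimately show ?thesis using True r by simp
    qed (simp add: fejer_nonneg)
    show "integrable lborel (\<lambda>x. c * indicator {r/2..r} x)"
      by (intro integrable_mult_right integrable_real_indicator) (auto simp: emeasure_lborel_Icc_eq)
  qed
  finally show ?thesis .
qed

lemma fejer_window_le: "(\<integral>u. indicator {-R..R} u * fejer u \<partial>lborel) \<le> fejer_mass"
  unfolding fejer_mass_def
  by (intro integral_mono fejer_window_integrable fejer_integrable) (auto simp: indicator_def fejer_nonneg)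

lemma fejer_mass_pos: "fejer_mass > 0"
  using fejer_window_pos[of 1] fejer_window_le[of 1] by simp

lemma fejer_scaled:
  assumes "l > 0"
  shows "integrable lborel (\<lambda>t. fejer (l * (x - t)))"
    and "(\<integral>t. fejer (l * (x - t)) \<partial>lborel) = fejer_mass / l"
proof -
  have eq: "fejer (l * (x - t)) = fejer (l * x + (- l) * t)" for t by (simp add: algebra_simps)
  show "integrable lborel (\<lambda>t. fejer (l * (x - t)))"
    unfolding eq using assms by (intro lborel_integrable_real_affine fejer_integrable) auto
  show "(\<integral>t. fejer (l * (x - t)) \<partial>lborel) = fejer_mass / l"
    using lborel_integral_real_affine[of "-l" fejer "l * x"] assms
    unfolding eq by (simp add: fejer_mass_def)
qed

text \<open>The kernel is replaced by its Fourier integral and the order of integration is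
  exchanged; the inner integral is then the transform at \<open>e + \<i> * l * y\<close>. Since
  \<open>tri\<close> vanishes outside the interval from \<open>-1\<close> to \<open>1\<close>, only
  the segment with \<open>\<bar>Im s\<bar> \<le> l\<close> contributes.\<close>

lemma laplace_fejer:
  assumes f: "laplace_conv f 0" and e: "e > 0"
  shows "(\<integral>t. f t * exp (- (of_real e * of_real t)) * of_real (fejer (l * (x - t))) \<partial>lborel) =
         (\<integral>y. of_real (tri y) * exp (\<i> * of_real (l * x * y)) * laplace f (Complex e (l * y)) \<partial>lborel)"
proof -
  have [measurable]: "f \<in> borel_measurable borel"
    using f by (simp add: laplace_conv_def)
  define F where "F y t = f t * exp (- (of_real e * of_real t)) *
      (of_real (tri y) * exp (\<i> * of_real (l * (x - t) * y)))" for y t :: real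
  have [measurable]: "case_prod F \<in> borel_measurable (lborel \<Otimes>\<^sub>M lborel)"
    unfolding F_def by measurable
  have fi: "integrable lborel (\<lambda>t. f t * exp (- (of_real e * of_real t)))"
    using laplace_integrable[OF f, of "of_real e"] e by simp
  \<comment> \<open>The oscillating factor is unimodular, so the norm is a product of a function of
    \<open>y\<close> and a function of \<open>t\<close>, both integrable; this justifies
    Fubini.\<close>
  have nF: "norm (F y t) = tri y * norm (f t * exp (- (of_real e * of_real t)))" for y t
    by (simp add: F_def norm_mult tri_nonneg)
  have int: "integrable (lborel \<Otimes>\<^sub>M lborel) (case_prod F)"
  proof (rule lborel_pair.Fubini_integrable)
    show "integrable lborel (\<lambda>y. LINT t|lborel. norm (case (y, t) of (y, t) \<Rightarrow> F y t))"
      using tri_integrable by (simp add: nF)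
    have "integrable lborel (\<lambda>t. F y t)" for y
      by (rule Bochner_Integration.integrable_bound[OF integrable_mult_right[OF fi, of "of_real (tri y)"]])
         (auto simp: F_def norm_mult tri_nonneg)
    then show "AE y in lborel. integrable lborel (\<lambda>t. case (y, t) of (y, t) \<Rightarrow> F y t)" by simp
  qed simp
  have "(\<integral>t. f t * exp (- (of_real e * of_real t)) * of_real (fejer (l * (x - t))) \<partial>lborel) =
    (\<integral>t. (\<integral>y. F y t \<partial>lborel) \<partial>lborel)"
    unfolding F_def integral_mult_right_zero fejer_fourier ..
  also have "\<dots> = (\<integral>y. (\<integral>t. F y t \<partial>lborel) \<partial>lborel)"
    by (rule lborel_pair.Fubini_integral[OF int])
  also have "(\<lambda>y. \<integral>t. F y t \<partial>lborel) = (\<lambda>y. of_real (tri y) * exp (\<i> * of_real (l * x * y)) * laplace f (Complex e (l * y)))"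
  proof (rule ext)
    fix y
    have "F y t = of_real (tri y) * exp (\<i> * of_real (l * x * y)) * (f t * exp (- (Complex e (l * y) * of_real t)))" for t
    proof -
      have "exp (- (of_real e * of_real t)) * exp (\<i> * of_real (l * (x - t) * y)) =
        exp (\<i> * of_real (l * x * y)) * exp (- (Complex e (l * y) * of_real t))"
        by (simp flip: exp_add add: Complex_eq algebra_simps)
      then show ?thesis by (simp add: F_def mult_ac)
    qed
    then show "(\<integral>t. F y t \<partial>lborel) = of_real (tri y) * exp (\<i> * of_real (l * x * y)) * laplace f (Complex e (l * y))"
      by (simp add: laplace_def)
  qed
  finally show ?thesis .
qed

text \<open>Dominated convergence on the Fourier side. The bound \<open>near\<close> supplies the
  integrable majorant and \<open>away\<close> the pointwise limit, because
  \<open>x powr (1 - b)\<close> tends to \<open>0\<close> for \<open>b > 1\<close>. The bad point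
  \<open>y = 0\<close> is a null set.\<close>

lemma fejer_laplace_tendsto_0:
  assumes f: "laplace_conv f 0" and b: "b > 1" and l: "l > 0"
    and near: "\<And>\<eta>. \<exists>r>0. \<exists>K. \<forall>e \<eta>'. 0 < e \<and> e < r \<and> \<bar>\<eta>' - \<eta>\<bar> < r \<longrightarrow> norm (laplace f (Complex e \<eta>')) \<le> K * e powr (1 - b)"
    and away: "\<And>\<eta>. \<eta> \<noteq> 0 \<Longrightarrow> \<exists>r>0. \<exists>K. \<forall>e. 0 < e \<and> e < r \<longrightarrow> norm (laplace f (Complex e \<eta>)) \<le> K"
  shows "((\<lambda>x. of_real (x powr (1 - b)) *
      (\<integral>t. f t * exp (- (of_real (1 / x) * of_real t)) * of_real (fejer (l * (x - t))) \<partial>lborel)) \<longlongrightarrow> 0) at_top"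
proof -
  have [measurable]: "f \<in> borel_measurable borel"
    using f by (simp add: laplace_conv_def)
  obtain r K where r: "\<And>\<eta>. r \<eta> > 0" and
    K: "\<And>\<eta> e \<eta>'. 0 < e \<Longrightarrow> e < r \<eta> \<Longrightarrow> \<bar>\<eta>' - \<eta>\<bar> < r \<eta> \<Longrightarrow> norm (laplace f (Complex e \<eta>')) \<le> K \<eta> * e powr (1 - b)"
    using near by metis
  \<comment> \<open>Compactness turns the local bounds \<open>near\<close> into a single bound, with
    constants \<open>r0\<close> and \<open>K0\<close>, valid on the whole segment.\<close>
  have "compact {-l..l}" by simp
  then obtain D where D: "D \<subseteq> {-l..l}" "finite D" "{-l..l} \<subseteq> (\<Union>\<eta>\<in>D. ball \<eta> (r \<eta>))"
    by (rule compactE_image[of _ "{-l..l}" "\<lambda>\<eta>. ball \<eta> (r \<eta>)"]) (use r in \<open>force+\<close>)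
  have "D \<noteq> {}" using D(3) l by fastforce
  define r0 where "r0 = Min (r ` D)"
  define K0 where "K0 = Max (K ` D)"
  have r0: "r0 > 0" using D(2) \<open>D \<noteq> {}\<close> r by (simp add: r0_def)
  have K0: "norm (laplace f (Complex e \<eta>)) \<le> K0 * e powr (1 - b)" if "0 < e" "e < r0" "\<eta> \<in> {-l..l}" for e \<eta>
  proof -
    from that D(3) obtain \<eta>0 where "\<eta>0 \<in> D" "\<bar>\<eta> - \<eta>0\<bar> < r \<eta>0" by (auto simp: dist_real_def abs_minus_commute)
    moreover from this have "r0 \<le> r \<eta>0" "K \<eta>0 \<le> K0" using D(2) by (auto simp: r0_def K0_def)
    ultimately show ?thesis using K[of e \<eta>0 \<eta>] that
      by (meson less_le_trans mult_right_mono order_trans powr_ge_zero)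
  qed
  define s where "s x y = of_real (x powr (1 - b)) * (of_real (tri y) * exp (\<i> * of_real (l * x * y)) *
      laplace f (Complex (1 / x) (l * y)))" for x y :: real
  have "((\<lambda>x. \<integral>y. s x y \<partial>lborel) \<longlongrightarrow> (\<integral>(y::real). 0 \<partial>lborel)) at_top"
  proof (rule integral_dominated_convergence_at_top[where s=s and f="\<lambda>_. 0" and M=lborel and w="\<lambda>y. K0 * tri y"])
    show "s x \<in> borel_measurable lborel" for x
      unfolding s_def laplace_def Complex_eq by measurable
    show "integrable lborel (\<lambda>y. K0 * tri y)" using tri_integrable by simp
    show "\<forall>\<^sub>F x in at_top. AE y in lborel. norm (s x y) \<le> K0 * tri y"
      using eventually_gt_at_top[of 0] eventually_gt_at_top[of "1 / r0"]
    proof eventually_elim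
      case (elim x)
      show ?case
      proof (intro AE_I2)
        fix y
        show "norm (s x y) \<le> K0 * tri y"
        proof (cases "\<bar>y\<bar> \<ge> 1")
          case False
          have "l * y \<in> {-l..l}" using False l
            using mult_left_mono[of y 1 l] mult_left_mono[of "-1" y l] by auto
          then have "norm (laplace f (Complex (1 / x) (l * y))) \<le> K0 * (1 / x) powr (1 - b)"
            using elim r0 by (intro K0) (auto simp: field_simps)
          then have "x powr (1 - b) * norm (laplace f (Complex (1 / x) (l * y))) \<le> x powr (1 - b) * (K0 * (1 / x) powr (1 - b))"
            by (rule mult_left_mono) auto
          \<comment> \<open>With the damping tied to \<open>x\<close> by \<open>e = 1 / x\<close>,
            the permitted growth \<open>e powr (1 - b)\<close> cancels the normalising factor
            exactly.\<close>
          also have "\<dots> = K0" using elim by (simp add: powr_divide)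
          finally show ?thesis using tri_nonneg[of y]
            by (simp add: s_def norm_mult mult_ac mult_left_mono)
              (metis mult.commute mult.left_commute mult_left_mono)
        qed (simp add: s_def tri_eq_0)
      qed
    qed
    show "AE y in lborel. ((\<lambda>x. s x y) \<longlongrightarrow> 0) at_top"
      using AE_lborel_singleton[of 0]
    proof eventually_elim
      case (elim y)
      then obtain r K where rK: "r > 0" "\<And>e. 0 < e \<Longrightarrow> e < r \<Longrightarrow> norm (laplace f (Complex e (l * y))) \<le> K"
        using away[of "l * y"] l by auto
      have "\<forall>\<^sub>F x in at_top. norm (s x y) \<le> K * x powr (1 - b)"
        using eventually_gt_at_top[of 0] eventually_gt_at_top[of "1 / r"]
      proof eventually_elim
        case (elim x)
        have *: "norm (laplace f (Complex (1 / x) (l * y))) \<le> K"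
          using elim rK(1) by (intro rK(2)) (auto simp: field_simps)
        have "tri y * norm (laplace f (Complex (1 / x) (l * y))) \<le> 1 * K"
          by (intro mult_mono * tri_le_1) auto
        from mult_right_mono[OF this, of "x powr (1 - b)"] show ?case
          by (simp add: s_def norm_mult tri_nonneg mult_ac)
      qed
      moreover have "((\<lambda>x. K * x powr (1 - b)) \<longlongrightarrow> 0) at_top"
        using tendsto_mult_right_zero[OF tendsto_neg_powr[of "1 - b", OF _ filterlim_ident]] b by simp
      ultimately show ?case by (rule Lim_null_comparison)
    qed
  qed simp
  then have "((\<lambda>x. \<integral>y. s x y \<partial>lborel) \<longlongrightarrow> 0) at_top" by simp
  then show ?thesis
  proof (rule Lim_transform_eventually)
    show "\<forall>\<^sub>F x in at_top. (\<integral>y. s x y \<partial>lborel) = of_real (x powr (1 - b)) *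
      (\<integral>t. f t * exp (- (of_real (1 / x) * of_real t)) * of_real (fejer (l * (x - t))) \<partial>lborel)"
      using eventually_gt_at_top[of 0]
    proof eventually_elim
      case (elim x)
      show ?case using laplace_fejer[OF f, of "1 / x" l x] elim
        by (simp only: s_def) simp
    qed
  qed
qed

subsection \<open>Removing the kernel average\<close>

text \<open>The inequality \<open>u / c \<le> exp (u / c)\<close> is solved for \<open>u\<close> and
  raised to the power \<open>c\<close>.\<close>

lemma powr_mult_exp_le:
  fixes c u :: real
  assumes "c > 0" "u \<ge> 0"
  shows "u powr c * exp (- u) \<le> c powr c"
proof -
  have "u / c \<le> exp (u / c)" using exp_ge_add_one_self[of "u / c"] by linarith
  then have "u \<le> c * exp (u / c)" using assms by (simp add: field_simps)
  then have "u powr c \<le> (c * exp (u / c)) powr c"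
    using assms by (intro powr_mono2) auto
  also have "\<dots> = c powr c * exp u"
    using assms by (simp add: powr_mult exp_powr_real)
  finally show ?thesis by (simp add: exp_minus field_simps)
qed

lemma norm_powr_density:
  "norm (powr_density \<beta> t) = (if t > 0 then t powr (Re \<beta> - 1) else 0)"
  by (simp add: powr_density_def norm_powr_real_powr)

text \<open>Substituting \<open>t = x - v\<close> and normalising turns the integrand into
  \<open>q (1 - v / x)\<close> times the kernel at \<open>l * v\<close>. Here \<open>q\<close> is
  bounded because \<open>Re \<beta> > 1\<close>, and it tends to \<open>q 1\<close>, which is
  \<open>exp (-1)\<close>: the damping factor at \<open>t = x\<close>.\<close>

lemma powr_density_fejer_limit:
  assumes b: "Re \<beta> > 1" and l: "l > 0"
  shows "((\<lambda>x. of_real x powr (1 - \<beta>) *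
      (\<integral>t. powr_density \<beta> t * exp (- (of_real (1 / x) * of_real t)) * of_real (fejer (l * (x - t))) \<partial>lborel))
      \<longlongrightarrow> of_real (exp (-1) * fejer_mass / l)) at_top"
proof -
  define q where "q u = powr_density \<beta> u * exp (- of_real u)" for u
  define Q where "Q = (Re \<beta> - 1) powr (Re \<beta> - 1)"
  have [measurable]: "powr_density \<beta> \<in> borel_measurable borel"
    unfolding powr_density_def powr_def by measurable
  have [measurable]: "q \<in> borel_measurable borel"
    unfolding q_def by measurable
  have q: "norm (q u) \<le> Q" for u
    using powr_mult_exp_le[of "Re \<beta> - 1" u] b by (auto simp: q_def norm_mult norm_powr_density Q_def)
  have qlim: "((\<lambda>x. q (1 - v / x)) \<longlongrightarrow> of_real (exp (-1))) at_top" for v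
  proof -
    have lim: "((\<lambda>x. 1 - v / x) \<longlongrightarrow> 1 - 0) at_top"
      by (intro tendsto_intros tendsto_divide_0[OF tendsto_const] filterlim_at_top_imp_at_infinity filterlim_ident)
    then have lim: "((\<lambda>x. 1 - v / x) \<longlongrightarrow> 1) at_top" by simp
    have ev: "\<forall>\<^sub>F x in at_top. 1 - v / x > 0"
      by (rule order_tendstoD(1)[OF lim]) simp
    have "((\<lambda>x. of_real (1 - v / x) powr (\<beta> - 1) * exp (- complex_of_real (1 - v / x))) \<longlongrightarrow>
        of_real 1 powr (\<beta> - 1) * exp (- of_real 1)) at_top"
      by (intro tendsto_intros lim) auto
    then have "((\<lambda>x. of_real (1 - v / x) powr (\<beta> - 1) * exp (- complex_of_real (1 - v / x))) \<longlongrightarrow>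
        of_real (exp (-1))) at_top"
      by (simp flip: exp_of_real)
    then show ?thesis
      by (rule Lim_transform_eventually) (use ev in eventually_elim, simp add: q_def powr_density_def)
  qed
  have fi: "integrable lborel (\<lambda>v. fejer (l * v))"
    using lborel_integrable_real_affine[OF fejer_integrable, of l 0] l by simp
  have fm: "(\<integral>v. fejer (l * v) \<partial>lborel) = fejer_mass / l"
    using lborel_integral_real_affine[of l fejer 0] l by (simp add: fejer_mass_def)
  have "((\<lambda>x. \<integral>v. q (1 - v / x) * of_real (fejer (l * v)) \<partial>lborel) \<longlongrightarrow>
     (\<integral>v. of_real (exp (-1)) * of_real (fejer (l * v)) \<partial>lborel)) at_top"
  proof (rule integral_dominated_convergence_at_top[where w="\<lambda>v. Q * fejer (l * v)"])
    show "integrable lborel (\<lambda>v. Q * fejer (l * v))" using fi by simp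
    show "AE v in lborel. ((\<lambda>x. q (1 - v / x) * of_real (fejer (l * v))) \<longlongrightarrow>
         of_real (exp (-1)) * of_real (fejer (l * v))) at_top"
      by (intro AE_I2 tendsto_intros qlim)
    show "\<forall>\<^sub>F x in at_top. AE v in lborel. norm (q (1 - v / x) * of_real (fejer (l * v))) \<le> Q * fejer (l * v)"
      using q fejer_nonneg by (intro always_eventually allI AE_I2) (auto simp: norm_mult intro!: mult_mono order_trans[OF norm_ge_zero q])
  qed measurable
  moreover have "(\<integral>v. complex_of_real (exp (-1)) * of_real (fejer (l * v)) \<partial>lborel) = of_real (exp (-1) * fejer_mass / l)"
    by (simp add: fm flip: of_real_mult)
  ultimately have "((\<lambda>x. \<integral>v. q (1 - v / x) * of_real (fejer (l * v)) \<partial>lborel) \<longlongrightarrow> of_real (exp (-1) * fejer_mass / l)) at_top"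
    by simp
  then show ?thesis
  proof (rule Lim_transform_eventually)
    show "\<forall>\<^sub>F x in at_top. (\<integral>v. q (1 - v / x) * of_real (fejer (l * v)) \<partial>lborel) = of_real x powr (1 - \<beta>) *
      (\<integral>t. powr_density \<beta> t * exp (- (of_real (1 / x) * of_real t)) * of_real (fejer (l * (x - t))) \<partial>lborel)"
      using eventually_gt_at_top[of 0]
    proof eventually_elim
      case (elim x)
      have eq: "of_real x powr (1 - \<beta>) * (powr_density \<beta> t * exp (- (of_real (1 / x) * of_real t)) * of_real (fejer (l * (x - t))))
         = q (t / x) * of_real (fejer (l * (x - t)))" for t
      proof (cases "t > 0")
        case True
        have "complex_of_real (t / x) powr (\<beta> - 1) = (of_real t * of_real (inverse x)) powr (\<beta> - 1)"
          by (simp add: divide_inverse)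
        also have "\<dots> = of_real t powr (\<beta> - 1) * of_real (inverse x) powr (\<beta> - 1)"
          using True elim by (intro powr_times_real) auto
        also have "of_real (inverse x) powr (\<beta> - 1) = of_real x powr (1 - \<beta>)"
          using elim by (simp add: powr_def Ln_of_real ln_inverse flip: of_real_inverse)
            (simp add: algebra_simps)
        finally show ?thesis using True elim by (simp add: q_def powr_density_def)
      qed (use elim in \<open>simp add: q_def powr_density_def divide_simps\<close>)
      have "of_real x powr (1 - \<beta>) *
        (\<integral>t. powr_density \<beta> t * exp (- (of_real (1 / x) * of_real t)) * of_real (fejer (l * (x - t))) \<partial>lborel) =
        (\<integral>t. q (t / x) * of_real (fejer (l * (x - t))) \<partial>lborel)"
        by (simp only: eq flip: integral_mult_right_zero)
      also have "\<dots> = (\<integral>v. q ((x + (-1) * v) / x) * of_real (fejer (l * (x - (x + (-1) * v)))) \<partial>lborel)"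
        by (subst lborel_integral_real_affine[of "-1" _ x]) auto
      also have "\<dots> = (\<integral>v. q (1 - v / x) * of_real (fejer (l * v)) \<partial>lborel)"
        using elim by (simp add: diff_divide_distrib)
      finally show ?case ..
    qed
  qed
qed

text \<open>The hypothesis \<open>slow\<close> lets \<open>B\<close> be compared with its values in
  a short window. A window to the right of \<open>x\<close> bounds \<open>B x\<close> from above by
  a kernel average, one to the left bounds it from below up to the kernel mass outside the window.
  That tail is controlled by an a priori growth bound obtained from the upper estimate.\<close>

lemma fejer_tauberian:
  fixes B :: "real \<Rightarrow> real"
  assumes nonneg: "\<And>t. B t \<ge> 0" and zero: "\<And>t. t < 0 \<Longrightarrow> B t = 0"
    and slow: "\<And>x y. x \<le> y \<Longrightarrow> B x * exp (- (a * (y - x))) \<le> B y"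
    and a: "a \<ge> 0" and b: "b > 1"
    and int: "\<And>x l. x > 0 \<Longrightarrow> l > 0 \<Longrightarrow> integrable lborel (\<lambda>t. B t * exp (- (t / x)) * fejer (l * (x - t)))"
    and lim: "\<And>l. l > 0 \<Longrightarrow> ((\<lambda>x. x powr (1 - b) * (\<integral>t. B t * exp (- (t / x)) * fejer (l * (x - t)) \<partial>lborel))
       \<longlongrightarrow> c * (exp (-1) * fejer_mass / l)) at_top"
  shows "((\<lambda>x. x powr (1 - b) * B x) \<longlongrightarrow> c) at_top"
proof -
  have slow': "B x \<le> B y * exp (a * (y - x))" if "x \<le> y" for x y
    using mult_right_mono[OF slow[OF that], of "exp (a * (y - x))"]
    by (simp add: mult.assoc flip: exp_add)
  define I where "I l x = (\<integral>t. B t * exp (- (t / x)) * fejer (l * (x - t)) \<partial>lborel)" for l x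
  define m where "m R = (\<integral>u. indicator {-R..R} u * fejer u \<partial>lborel)" for R :: real
  have m_lim: "(m \<longlongrightarrow> fejer_mass) at_top"
    unfolding m_def fejer_mass_def
  proof (rule integral_dominated_convergence_at_top[where w=fejer])
    show "AE u in lborel. ((\<lambda>R. indicator {-R..R} u * fejer u) \<longlongrightarrow> fejer u) at_top"
    proof (intro AE_I2)
      fix u :: real
      have "\<forall>\<^sub>F R in at_top. fejer u = indicator {-R..R} u * fejer u"
        using eventually_ge_at_top[of "\<bar>u\<bar>"] by eventually_elim (auto simp: indicator_def)
      then show "((\<lambda>R. indicator {-R..R} u * fejer u) \<longlongrightarrow> fejer u) at_top"
        by (rule Lim_transform_eventually[OF tendsto_const])
    qed
    show "\<forall>\<^sub>F R in at_top. AE u in lborel. norm (indicator {-R..R} u * fejer u) \<le> fejer u"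
      by (intro always_eventually allI AE_I2) (auto simp: indicator_def fejer_nonneg)
  qed (use fejer_integrable in measurable)
  have m_le: "m R \<le> fejer_mass" for R
    unfolding m_def by (rule fejer_window_le)
  have m_pos: "m R > 0" if "R > 0" for R
    unfolding m_def by (rule fejer_window_pos[OF that])
  \<comment> \<open>The change of variable \<open>u = l * (x - t)\<close> maps the window of
    half-width \<open>d\<close> around \<open>x\<close> to the one of half-width
    \<open>l * d\<close> around \<open>0\<close>.\<close>
  have window: "integrable lborel (\<lambda>t. indicator {x - d..x + d} t * fejer (l * (x - t)))"
     "(\<integral>t. indicator {x - d..x + d} t * fejer (l * (x - t)) \<partial>lborel) = m (l * d) / l"
    if "l > 0" for l d x
  proof -
    have eq: "indicator {x - d..x + d} t * fejer (l * (x - t)) =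
        (\<lambda>u. indicator {-(l*d)..l*d} u * fejer u) (l * x + (-l) * t)" for t
    proof -
      have "l * x + (-l) * t = l * (x - t)" by (simp add: algebra_simps)
      moreover have "l * (x - t) \<in> {-(l*d)..l*d} \<longleftrightarrow> t \<in> {x - d..x + d}"
      proof -
        have "- (l * d) \<le> l * (x - t) \<longleftrightarrow> l * (-d) \<le> l * (x - t)" by simp
        also have "\<dots> \<longleftrightarrow> - d \<le> x - t" using that by (subst mult_le_cancel_left_pos) auto
        finally show ?thesis using that by auto
      qed
      ultimately show ?thesis by (simp add: indicator_def)
    qed
    show "integrable lborel (\<lambda>t. indicator {x - d..x + d} t * fejer (l * (x - t)))"
      unfolding eq using that by (intro lborel_integrable_real_affine fejer_window_integrable) auto
    show "(\<integral>t. indicator {x - d..x + d} t * fejer (l * (x - t)) \<partial>lborel) = m (l * d) / l"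
      unfolding eq m_def using that
      by (subst (2) lborel_integral_real_affine[of "-l" _ "l * x"]) auto
  qed
  \<comment> \<open>The kernel is centred at \<open>x + d\<close>, so its window runs from
    \<open>x\<close> to \<open>x + 2 * d\<close>. There \<open>B t\<close> is at least
    \<open>B x * exp (- (2 * a * d))\<close>, and the damping is smallest at the right end. The
    contribution outside the window is nonnegative and is dropped.\<close>
  have upper: "B x * (exp (- (2 * a * d)) * exp (- ((x + 2 * d) / (x + d)))) * (m (l * d) / l) \<le> I l (x + d)"
    if "l > 0" "d > 0" "x > 0" for l d x
  proof -
    have "(\<integral>t. B x * (exp (- (2 * a * d)) * exp (- ((x + 2 * d) / (x + d)))) *
        (indicator {(x + d) - d..(x + d) + d} t * fejer (l * ((x + d) - t))) \<partial>lborel) \<le> I l (x + d)"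
      unfolding I_def
    proof (rule integral_mono)
      fix t
      show "B x * (exp (- (2 * a * d)) * exp (- ((x + 2 * d) / (x + d)))) *
        (indicator {(x + d) - d..(x + d) + d} t * fejer (l * ((x + d) - t)))
        \<le> B t * exp (- (t / (x + d))) * fejer (l * (x + d - t))"
      proof (cases "t \<in> {(x + d) - d..(x + d) + d}")
        case True
        have "a * (t - x) \<le> a * (2 * d)" using True a by (intro mult_left_mono) auto
        then have "B x * exp (- (2 * a * d)) \<le> B x * exp (- (a * (t - x)))"
          by (intro mult_left_mono nonneg) (simp add: mult_ac)
        also have "\<dots> \<le> B t" using True by (intro slow) auto
        finally have "B x * exp (- (2 * a * d)) * exp (- ((x + 2 * d) / (x + d))) \<le> B t * exp (- (t / (x + d)))"
          using True that by (intro mult_mono nonneg) (auto intro!: divide_right_mono)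
        then have "B x * exp (- (2 * a * d)) * exp (- ((x + 2 * d) / (x + d))) * fejer (l * ((x + d) - t))
            \<le> B t * exp (- (t / (x + d))) * fejer (l * ((x + d) - t))"
          by (rule mult_right_mono) (rule fejer_nonneg)
        then show ?thesis using True by (simp add: mult.assoc)
      qed (simp add: nonneg fejer_nonneg)
    next
      show "integrable lborel (\<lambda>t. B x * (exp (- (2 * a * d)) * exp (- ((x + 2 * d) / (x + d)))) *
        (indicator {(x + d) - d..(x + d) + d} t * fejer (l * ((x + d) - t))))"
        by (rule integrable_mult_right[OF window(1)[OF that(1)]])
    qed (use that in \<open>auto intro!: int\<close>)
    then show ?thesis by (simp only: integral_mult_right_zero window(2)[OF that(1)])
  qed
  \<comment> \<open>This quotient converts the normalisation at the shifted centre into the one at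
    \<open>x\<close>.\<close>
  have ratio: "((\<lambda>x. (x / (x + d)) powr (1 - b)) \<longlongrightarrow> 1) at_top" for d :: real
  proof -
    have "((\<lambda>x. x / (x + d)) \<longlongrightarrow> 1) at_top" by real_asymp
    then have "((\<lambda>x. (x / (x + d)) powr (1 - b)) \<longlongrightarrow> 1 powr (1 - b)) at_top"
      by (intro tendsto_intros) auto
    then show ?thesis by simp
  qed
  have shift: "filterlim (\<lambda>x. x + d) at_top at_top" for d :: real by real_asymp
  have Ilim: "((\<lambda>x. (x + d) powr (1 - b) * I l (x + d) * (x / (x + d)) powr (1 - b)) \<longlongrightarrow> c * (exp (-1) * fejer_mass / l) * 1) at_top"
    if "l > 0" for l d
    unfolding I_def
    by (rule tendsto_mult[OF filterlim_compose[OF lim[OF that] shift] ratio])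
  have pw: "(x + d) powr (1 - b) * (x / (x + d)) powr (1 - b) = x powr (1 - b)" if "x > 0" "x + d > 0" for x d
    using that by (simp add: powr_divide)
  \<comment> \<open>\<open>upper\<close> solved for \<open>B x\<close>. In the limit the factor
    \<open>exp 1\<close> from the damping cancels the \<open>exp (-1)\<close> in
    \<open>lim\<close>.\<close>
  have U: "((\<lambda>x. (x + d) powr (1 - b) * I l (x + d) * (x / (x + d)) powr (1 - b) *
        (exp (2 * a * d) * exp ((x + 2 * d) / (x + d)) * (l / m (l * d)))) \<longlongrightarrow>
        c * exp (2 * a * d) * (fejer_mass / m (l * d))) at_top" (is "(?U l d \<longlongrightarrow> _) at_top")
    and U_ge: "\<forall>\<^sub>F x in at_top. x powr (1 - b) * B x \<le> (x + d) powr (1 - b) * I l (x + d) * (x / (x + d)) powr (1 - b) *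
        (exp (2 * a * d) * exp ((x + 2 * d) / (x + d)) * (l / m (l * d)))"
    if "l > 0" "d > 0" for l d
  proof -
    have "((\<lambda>x. (x + 2 * d) / (x + d)) \<longlongrightarrow> 1) at_top" by real_asymp
    then have "(?U l d \<longlongrightarrow> c * (exp (-1) * fejer_mass / l) * 1 * (exp (2 * a * d) * exp 1 * (l / m (l * d)))) at_top"
      by (intro tendsto_mult[OF Ilim[OF that(1)]] tendsto_intros)
    also have "c * (exp (-1) * fejer_mass / l) * 1 * (exp (2 * a * d) * exp 1 * (l / m (l * d)))
        = c * exp (2 * a * d) * (fejer_mass / m (l * d))"
      using that by (simp add: exp_minus)
    finally show "(?U l d \<longlongrightarrow> c * exp (2 * a * d) * (fejer_mass / m (l * d))) at_top" .
    show "\<forall>\<^sub>F x in at_top. x powr (1 - b) * B x \<le> ?U l d x"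
      using eventually_gt_at_top[of 0]
    proof eventually_elim
      case (elim x)
      have mp: "m (l * d) > 0" using that by (intro m_pos) auto
      let ?E = "exp (- (2 * a * d)) * exp (- ((x + 2 * d) / (x + d)))"
      have "B x * ?E * (m (l * d) / l) \<le> I l (x + d)" using upper[OF that] elim .
      then have "B x * ?E * (m (l * d) / l) * (exp (2 * a * d) * exp ((x + 2 * d) / (x + d)) * (l / m (l * d))) \<le>
        I l (x + d) * (exp (2 * a * d) * exp ((x + 2 * d) / (x + d)) * (l / m (l * d)))"
        using that mp by (intro mult_right_mono) auto
      also have "B x * ?E * (m (l * d) / l) * (exp (2 * a * d) * exp ((x + 2 * d) / (x + d)) * (l / m (l * d))) = B x"
        using that mp by (simp add: exp_minus field_simps)
      finally have "x powr (1 - b) * B x \<le> x powr (1 - b) * (I l (x + d) * (exp (2 * a * d) * exp ((x + 2 * d) / (x + d)) * (l / m (l * d))))"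
        by (rule mult_left_mono) auto
      also have "\<dots> = ?U l d x" using pw[of x d] elim that by (simp add: mult_ac)
      finally show ?case .
    qed
  qed
  \<comment> \<open>The upper estimate with \<open>l = d = 1\<close> already gives
    \<open>B t \<le> C1 * t powr (b - 1)\<close> for large \<open>t\<close>; \<open>slow'\<close>
    covers the remaining bounded range. The damping then absorbs \<open>(t / y) powr (b - 1)\<close>
    by \<open>powr_mult_exp_le\<close>, which makes the bound uniform in \<open>t\<close>.\<close>
  obtain S where S: "S \<ge> 0" "\<And>t y. y \<ge> 1 \<Longrightarrow> B t * exp (- (t / y)) \<le> S * y powr (b - 1)"
  proof -
    \<comment> \<open>The summand \<open>1\<close> makes the limit strictly smaller than
      \<open>C1\<close>, as needed for an eventual bound.\<close>
    define C1 where "C1 = \<bar>c * exp (2 * a * 1) * (fejer_mass / m (1 * 1))\<bar> + 1"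
    have "c * exp (2 * a * 1) * (fejer_mass / m (1 * 1)) < C1"
      unfolding C1_def by (rule le_less_trans[OF abs_ge_self]) simp
    then have "\<forall>\<^sub>F x in at_top. ?U 1 1 x < C1"
      by (intro order_tendstoD(2)[OF U]) auto
    with U_ge[of 1 1] have "\<forall>\<^sub>F x in at_top. x powr (1 - b) * B x \<le> C1"
      by (auto elim: eventually_elim2)
    then obtain X where X: "\<And>x. x \<ge> X \<Longrightarrow> x powr (1 - b) * B x \<le> C1"
      by (auto simp: eventually_at_top_linorder)
    define X0 where "X0 = max X 1"
    define C2 where "C2 = B X0 * exp (a * X0)"
    define Q where "Q = (b - 1) powr (b - 1)"
    have pos: "C1 \<ge> 0" "C2 \<ge> 0" "Q \<ge> 0" by (auto simp: C1_def C2_def Q_def nonneg)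
    show thesis
    proof (rule that[of "C2 + C1 * Q"])
      fix t y :: real assume y: "y \<ge> 1"
      have y1: "1 \<le> y powr (b - 1)" using y b by (intro ge_one_powr_ge_zero) auto
      show "B t * exp (- (t / y)) \<le> (C2 + C1 * Q) * y powr (b - 1)"
      proof (cases "t < 0")
        case False
        show ?thesis
        proof (cases "t \<le> X0")
          case True
          have "B t \<le> B X0 * exp (a * (X0 - t))" using True by (rule slow')
          also have "\<dots> \<le> C2" unfolding C2_def
            using False a by (intro mult_left_mono nonneg) (auto intro!: mult_left_mono)
          finally have "B t * exp (- (t / y)) \<le> C2 * 1"
            using False y pos by (intro mult_mono) auto
          also have "\<dots> \<le> (C2 + C1 * Q) * y powr (b - 1)"
            using pos y1 by (intro mult_mono) auto
          finally show ?thesis .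
        next
          case t: False
          then have t0: "t > 0" "t \<ge> X" by (auto simp: X0_def)
          have "B t = t powr (b - 1) * (t powr (1 - b) * B t)"
            using t0 by (simp flip: mult.assoc powr_add)
          also have "\<dots> \<le> t powr (b - 1) * C1" using t0 by (intro mult_left_mono X) auto
          also have "t powr (b - 1) = y powr (b - 1) * (t / y) powr (b - 1)"
            using t0 y by (simp add: powr_divide)
          finally have "B t * exp (- (t / y)) \<le> y powr (b - 1) * (t / y) powr (b - 1) * C1 * exp (- (t / y))"
            by (rule mult_right_mono) auto
          also have "\<dots> = y powr (b - 1) * C1 * ((t / y) powr (b - 1) * exp (- (t / y)))" by simp
          also have "\<dots> \<le> y powr (b - 1) * C1 * Q"
            unfolding Q_def using t0 y b pos by (intro mult_left_mono powr_mult_exp_le) auto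
          also have "\<dots> \<le> (C2 + C1 * Q) * y powr (b - 1)"
            using pos by (simp add: algebra_simps)
          finally show ?thesis .
        qed
      qed (use pos in \<open>simp add: zero\<close>)
    qed (use pos in auto)
  qed
  \<comment> \<open>Now the kernel is centred at \<open>x - d\<close> and its window ends at
    \<open>x\<close>. Inside, \<open>B t\<close> is at most \<open>B x * exp (2 * a * d)\<close>;
    outside, \<open>S\<close> bounds the damped function, so the error is \<open>S\<close> times the
    missing mass. The condition \<open>x \<ge> d + 1\<close> makes the damping scale
    \<open>x - d\<close> at least \<open>1\<close>.\<close>
  have lower: "I l (x - d) \<le> B x * (exp (2 * a * d) * exp (- ((x - 2 * d) / (x - d)))) * (fejer_mass / l) +
       S * (x - d) powr (b - 1) * ((fejer_mass - m (l * d)) / l)"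
    if "l > 0" "d > 0" "x \<ge> d + 1" for l d x
  proof -
    let ?E = "exp (2 * a * d) * exp (- ((x - 2 * d) / (x - d)))"
    let ?i = "indicator {(x - d) - d..(x - d) + d} :: real \<Rightarrow> real"
    let ?k = "\<lambda>t. fejer (l * ((x - d) - t))"
    have "I l (x - d) \<le> (\<integral>t. B x * ?E * (?i t * ?k t) + S * (x - d) powr (b - 1) * (?k t - ?i t * ?k t) \<partial>lborel)"
      unfolding I_def
    proof (rule integral_mono)
      fix t
      show "B t * exp (- (t / (x - d))) * ?k t \<le> B x * ?E * (?i t * ?k t) + S * (x - d) powr (b - 1) * (?k t - ?i t * ?k t)"
      proof (cases "t \<in> {(x - d) - d..(x - d) + d}")
        case True
        have "B t \<le> B x * exp (a * (x - t))" using True that by (intro slow') auto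
        also have "\<dots> \<le> B x * exp (2 * a * d)"
        proof -
          have "a * (x - t) \<le> a * (2 * d)" using True a by (intro mult_left_mono) auto
          then show ?thesis by (intro mult_left_mono nonneg) (simp add: mult_ac)
        qed
        finally have "B t * exp (- (t / (x - d))) \<le> B x * exp (2 * a * d) * exp (- ((x - 2 * d) / (x - d)))"
          using True that by (intro mult_mono nonneg) (auto intro!: divide_right_mono nonneg mult_nonneg_nonneg)
        then have "B t * exp (- (t / (x - d))) * ?k t \<le> B x * exp (2 * a * d) * exp (- ((x - 2 * d) / (x - d))) * ?k t"
          by (rule mult_right_mono) (rule fejer_nonneg)
        then show ?thesis using True by (simp add: mult.assoc)
      next
        case False
        have "B t * exp (- (t / (x - d))) * ?k t \<le> S * (x - d) powr (b - 1) * ?k t"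
          using that by (intro mult_right_mono S fejer_nonneg) auto
        then show ?thesis using False by simp
      qed
    qed (use that fejer_scaled(1)[of l "x - d"] window(1)[OF that(1), of "x - d" d] int[of "x - d" l] in \<open>auto\<close>)
    also have "\<dots> = B x * ?E * (m (l * d) / l) + S * (x - d) powr (b - 1) * (fejer_mass / l - m (l * d) / l)"
      using fejer_scaled[OF that(1), of "x - d"] window[OF that(1), of "x - d" d] by simp
    also have "\<dots> \<le> B x * ?E * (fejer_mass / l) + S * (x - d) powr (b - 1) * (fejer_mass / l - m (l * d) / l)"
      using that by (intro add_right_mono mult_left_mono divide_right_mono m_le) (auto simp: nonneg)
    finally show ?thesis by (simp add: diff_divide_distrib)
  qed
  \<comment> \<open>\<open>lower\<close> solved for \<open>B x\<close>. The centre is written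
    \<open>x + - d\<close> so that \<open>Ilim\<close> and \<open>ratio\<close> apply with the shift
    \<open>- d\<close>.\<close>
  define L where "L l d x = ((x + - d) powr (1 - b) * I l (x + - d) * (x / (x + - d)) powr (1 - b) * l -
         S * (fejer_mass - m (l * d)) * (x / (x + - d)) powr (1 - b)) *
        (exp (- (2 * a * d)) * exp ((x - 2 * d) / (x - d)) / fejer_mass)" for l d x
  have L_lim: "(L l d \<longlongrightarrow>
        (c - S * exp 1 * (1 - m (l * d) / fejer_mass)) * exp (- (2 * a * d))) at_top"
    and L_le: "\<forall>\<^sub>F x in at_top. L l d x \<le> x powr (1 - b) * B x"
    if "l > 0" "d > 0" for l d
  proof -
    have "((\<lambda>x. (x - 2 * d) / (x - d)) \<longlongrightarrow> 1) at_top" by real_asymp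
    then have "(L l d \<longlongrightarrow> (c * (exp (-1) * fejer_mass / l) * 1 * l - S * (fejer_mass - m (l * d)) * 1) *
       (exp (- (2 * a * d)) * exp 1 / fejer_mass)) at_top"
      unfolding L_def using fejer_mass_pos
      by (intro tendsto_mult[OF tendsto_diff[OF tendsto_mult[OF Ilim[OF that(1)]] tendsto_mult[OF _ ratio]]] tendsto_intros) auto
    also have "(c * (exp (-1) * fejer_mass / l) * 1 * l - S * (fejer_mass - m (l * d)) * 1) *
       (exp (- (2 * a * d)) * exp 1 / fejer_mass) = (c - S * exp 1 * (1 - m (l * d) / fejer_mass)) * exp (- (2 * a * d))"
      using that fejer_mass_pos by (simp add: exp_minus field_simps)
    finally show "(L l d \<longlongrightarrow> (c - S * exp 1 * (1 - m (l * d) / fejer_mass)) * exp (- (2 * a * d))) at_top" .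
    show "\<forall>\<^sub>F x in at_top. L l d x \<le> x powr (1 - b) * B x"
      using eventually_ge_at_top[of "d + 1"]
    proof eventually_elim
      case (elim x)
      have x: "x > 0" "x - d > 0" using elim that by auto
      have pw': "(x - d) powr (1 - b) * (x / (x - d)) powr (1 - b) = x powr (1 - b)"
        using pw[of x "-d"] x by simp
      have pw2: "x powr (1 - b) * (x - d) powr (b - 1) = (x / (x - d)) powr (1 - b)"
        using pw' x by (simp add: powr_divide powr_minus_divide[of "x - d" "1 - b", symmetric]) (simp add: field_simps flip: powr_add)
      let ?E = "exp (2 * a * d) * exp (- ((x - 2 * d) / (x - d)))"
      let ?E' = "exp (- (2 * a * d)) * exp ((x - 2 * d) / (x - d)) / fejer_mass"
      have "I l (x - d) * l \<le> (B x * ?E * (fejer_mass / l) + S * (x - d) powr (b - 1) * ((fejer_mass - m (l * d)) / l)) * l"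
        using lower[OF that elim] that by (intro mult_right_mono) auto
      also have "\<dots> = B x * (?E * fejer_mass) + S * (x - d) powr (b - 1) * (fejer_mass - m (l * d))"
        using that by (simp add: field_simps)
      finally have "x powr (1 - b) * (I l (x - d) * l) \<le>
         x powr (1 - b) * (B x * (?E * fejer_mass) + S * (x - d) powr (b - 1) * (fejer_mass - m (l * d)))"
        by (rule mult_left_mono) auto
      also have "\<dots> = x powr (1 - b) * B x * (?E * fejer_mass) + S * (fejer_mass - m (l * d)) * (x powr (1 - b) * (x - d) powr (b - 1))"
        by (simp add: algebra_simps)
      finally have "x powr (1 - b) * I l (x - d) * l - S * (fejer_mass - m (l * d)) * (x / (x - d)) powr (1 - b) \<le> x powr (1 - b) * B x * (?E * fejer_mass)"
        unfolding pw2 by (simp add: mult.assoc)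
      then have "(x powr (1 - b) * I l (x - d) * l - S * (fejer_mass - m (l * d)) * (x / (x - d)) powr (1 - b)) * ?E' \<le> x powr (1 - b) * B x * (?E * fejer_mass) * ?E'"
        using fejer_mass_pos by (intro mult_right_mono) auto
      also have "\<dots> = x powr (1 - b) * B x * (?E * fejer_mass * ?E')" by (simp only: mult.assoc)
      also have "?E * fejer_mass * ?E' = 1" using fejer_mass_pos by (simp add: exp_minus field_simps)
      finally show ?case unfolding mult_1_right pw'[symmetric] by (simp add: L_def mult_ac)
    qed
  qed
  have m_lim0: "((\<lambda>d. m (1 / d)) \<longlongrightarrow> fejer_mass) (at_right 0)"
    by (rule filterlim_compose[OF m_lim]) real_asymp
  have ml: "1 / d\<^sup>2 * d = 1 / d" for d :: real by (simp add: power2_eq_square)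
  txt \<open>Window width \<open>d\<close> and bandwidth \<open>1 / d\<^sup>2\<close>: as \<open>d \<longlonglongrightarrow> 0\<close> the window shrinks, while the kernel
    mass inside it tends to the full mass because \<open>1 / d\<^sup>2 * d \<longlonglongrightarrow> \<infinity>\<close>.\<close>
  show ?thesis
  proof (rule order_tendstoI)
    fix y assume y: "y < c"
    have "((\<lambda>d. (c - S * exp 1 * (1 - m (1 / d) / fejer_mass)) * exp (- (2 * a * d))) \<longlongrightarrow>
       (c - S * exp 1 * (1 - fejer_mass / fejer_mass)) * exp (- (2 * a * 0))) (at_right 0)"
      using fejer_mass_pos by (intro tendsto_intros m_lim0) auto
    then have "\<forall>\<^sub>F d in at_right 0. y < (c - S * exp 1 * (1 - m (1 / d) / fejer_mass)) * exp (- (2 * a * d))"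
      by (rule order_tendstoD(1)) (use y fejer_mass_pos in simp)
    then have "\<forall>\<^sub>F d in at_right 0. d > 0 \<and> y < (c - S * exp 1 * (1 - m (1 / d) / fejer_mass)) * exp (- (2 * a * d))"
      using eventually_at_right_less[of 0] by eventually_elim auto
    then obtain d where d: "d > 0" "y < (c - S * exp 1 * (1 - m (1 / d) / fejer_mass)) * exp (- (2 * a * d))"
      using eventually_happens'[OF trivial_limit_at_right_real] by blast
    have l: "1 / d\<^sup>2 > 0" using d by simp
    have "\<forall>\<^sub>F x in at_top. y < L (1 / d\<^sup>2) d x"
      by (rule order_tendstoD(1)[OF L_lim[OF l d(1)]]) (use d(2) in \<open>simp only: ml\<close>)
    then show "\<forall>\<^sub>F x in at_top. y < x powr (1 - b) * B x"
      using L_le[OF l d(1)] by eventually_elim linarith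
  next
    fix y assume y: "c < y"
    have "((\<lambda>d. c * exp (2 * a * d) * (fejer_mass / m (1 / d))) \<longlongrightarrow> c * exp (2 * a * 0) * (fejer_mass / fejer_mass)) (at_right 0)"
      using fejer_mass_pos by (intro tendsto_intros m_lim0) auto
    then have "\<forall>\<^sub>F d in at_right 0. c * exp (2 * a * d) * (fejer_mass / m (1 / d)) < y"
      by (rule order_tendstoD(2)) (use y fejer_mass_pos in simp)
    then have "\<forall>\<^sub>F d in at_right 0. d > 0 \<and> c * exp (2 * a * d) * (fejer_mass / m (1 / d)) < y"
      using eventually_at_right_less[of 0] by eventually_elim auto
    then obtain d where d: "d > 0" "c * exp (2 * a * d) * (fejer_mass / m (1 / d)) < y"
      using eventually_happens'[OF trivial_limit_at_right_real] by blast
    have l: "1 / d\<^sup>2 > 0" using d by simp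
    have "\<forall>\<^sub>F x in at_top. ?U (1 / d\<^sup>2) d x < y"
      by (rule order_tendstoD(2)[OF U[OF l d(1)]]) (use d(2) in \<open>simp only: ml\<close>)
    then show "\<forall>\<^sub>F x in at_top. x powr (1 - b) * B x < y"
      using U_ge[OF l d(1)] by eventually_elim linarith
  qed
qed

subsection \<open>A Tauberian theorem for power singularities\<close>

text \<open>The principal argument of \<open>s\<close> is at most \<open>pi\<close> in modulus, so
  the imaginary part of the exponent costs at most the factor
  \<open>exp (pi * \<bar>Im z\<bar>)\<close>.\<close>

lemma norm_powr_le:
  assumes "s \<noteq> 0"
  shows "norm (s powr z) \<le> norm s powr Re z * exp (pi * \<bar>Im z\<bar>)"
proof -
  have "norm (s powr z) = exp (Re z * ln (norm s) - Im z * Im (Ln s))"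
    using assms by (simp add: powr_def)
  also have "\<dots> = norm s powr Re z * exp (- (Im z * Im (Ln s)))"
    using assms by (simp add: powr_def exp_diff exp_minus divide_inverse)
  also have "\<dots> \<le> norm s powr Re z * exp (pi * \<bar>Im z\<bar>)"
  proof -
    have "\<bar>Im (Ln s)\<bar> \<le> pi" using assms mpi_less_Im_Ln[of s] Im_Ln_le_pi[of s] by auto
    then have "\<bar>Im z * Im (Ln s)\<bar> \<le> \<bar>Im z\<bar> * pi" unfolding abs_mult by (intro mult_left_mono) auto
    then show ?thesis by (intro mult_left_mono) (auto simp: mult.commute)
  qed
  finally show ?thesis .
qed

lemma holomorphic_bounded_near:
  assumes "G holomorphic_on ball s r" "r > 0"
  obtains K where "K \<ge> 0" "\<And>w. w \<in> cball s (r / 2) \<Longrightarrow> norm (G w) \<le> K"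
proof -
  have "continuous_on (cball s (r / 2)) G"
    using assms by (intro holomorphic_on_imp_continuous_on holomorphic_on_subset[OF assms(1)]) auto
  then have "bounded (G ` cball s (r / 2))"
    by (intro compact_imp_bounded compact_continuous_image) auto
  then obtain K where "\<And>w. w \<in> cball s (r / 2) \<Longrightarrow> norm (G w) \<le> K"
    unfolding bounded_iff by blast
  moreover have "K \<ge> 0"
    using calculation[of s] assms(2) order_trans[OF norm_ge_zero[of "G s"]] by auto
  ultimately show ?thesis using that by blast
qed

section \<open>Continuation and power singularities on the boundary line\<close>

definition continues_at :: "(complex \<Rightarrow> complex) \<Rightarrow> real \<Rightarrow> complex \<Rightarrow> bool" where
  "continues_at \<Psi> a s \<longleftrightarrow> (\<exists>r>0. \<exists>G. G holomorphic_on ball s r \<and> (\<forall>w\<in>ball s r. Re w > a \<longrightarrow> \<Psi> w = G w))"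

text \<open>\<open>G\<close> and \<open>H\<close> live on a full disk, while the identity is
  asserted only to the right of the line, where \<open>w - of_real a\<close> avoids the branch cut.
  The value \<open>c\<close> of the numerator at the centre may be \<open>0\<close>.\<close>

definition powr_singularity :: "(complex \<Rightarrow> complex) \<Rightarrow> real \<Rightarrow> complex \<Rightarrow> complex \<Rightarrow> bool" where
  "powr_singularity \<Psi> a \<beta> c \<longleftrightarrow> (\<exists>r>0. \<exists>G H. G holomorphic_on ball (of_real a) r \<and> H holomorphic_on ball (of_real a) r \<and>
     H (of_real a) = c \<and>
     (\<forall>w\<in>ball (of_real a) r. Re w > a \<longrightarrow> \<Psi> w = G w + H w * (w - of_real a) powr (- \<beta>)))"

text \<open>Subtracting the model \<open>L * powr_density \<beta>\<close> leaves a function whose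
  kernel averages are negligible, so the averages of \<open>B\<close> have the asymptotics of the
  model. Taking norms removes the phase and makes the real statement \<open>fejer_tauberian\<close>
  applicable. The phase is recovered afterwards, since \<open>B\<close> and a multiple of its
  average differ by a negligible amount.\<close>

lemma laplace_tauberian:
  fixes W :: "real \<Rightarrow> real"
  assumes mono: "mono W" and zero: "\<And>t. t < 0 \<Longrightarrow> W t = 0"
    and conv: "laplace_conv (\<lambda>t. of_real (W t)) a" and a: "a \<ge> 0" and b: "Re \<beta> > 1"
    and away: "\<And>s. Re s = a \<Longrightarrow> s \<noteq> of_real a \<Longrightarrow> continues_at (laplace (\<lambda>t. of_real (W t))) a s"
    and near: "powr_singularity (laplace (\<lambda>t. of_real (W t))) a \<beta> c"
  shows "((\<lambda>x. of_real (exp (- (a * x)) * W x) * of_real x powr (1 - \<beta>)) \<longlongrightarrow> c / Gamma \<beta>) at_top"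
proof -
  define b where "b = Re \<beta>"
  define L where "L = c / Gamma \<beta>"
  define B where "B t = exp (- (a * t)) * W t" for t
  define f where "f t = of_real (B t) - L * powr_density \<beta> t" for t
  have b1: "b > 1" using b by (simp add: b_def)
  have "\<beta> \<notin> \<int>\<^sub>\<le>\<^sub>0" using b by (auto elim!: nonpos_Ints_cases)
  then have G0: "Gamma \<beta> \<noteq> 0" by (simp add: Gamma_eq_zero_iff)
  have W0: "W t \<ge> 0" for t
    using zero[of "min t 0 - 1"] monoD[OF mono, of "min t 0 - 1" t] by auto
  have [measurable]: "W \<in> borel_measurable borel" using mono by (rule borel_measurable_mono)
  have Bint: "integrable lborel (\<lambda>t. B t * exp (- (e * t)))" if "e > 0" for e
  proof -
    have "integrable lborel (\<lambda>t. norm (complex_of_real (W t)) * exp (- ((a + e) * t)))"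
      using conv that by (simp add: laplace_conv_def)
    moreover have "norm (complex_of_real (W t)) * exp (- ((a + e) * t)) = B t * exp (- (e * t))" for t
      using W0[of t] by (simp add: B_def algebra_simps flip: exp_add)
    ultimately show ?thesis by simp
  qed
  have Bconv: "laplace_conv (\<lambda>t. of_real (B t)) 0"
    unfolding laplace_conv_def
  proof (intro conjI allI impI)
    have "norm (complex_of_real (B t)) = B t" for t using W0[of t] by (simp add: B_def norm_mult)
    then show "integrable lborel (\<lambda>t. norm (complex_of_real (B t)) * exp (- (e * t)))" if "e > 0" for e
      using Bint[OF that] by simp
  qed (simp_all add: B_def zero)
  have Blap: "laplace (\<lambda>t. of_real (B t)) s = laplace (\<lambda>t. of_real (W t)) (s + of_real a)" for s
  proof -
    have "complex_of_real (B t) * exp (- (s * of_real t)) = of_real (W t) * exp (- ((s + of_real a) * of_real t))" for t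
    proof -
      have "exp (- ((s + of_real a) * of_real t)) = of_real (exp (- (a * t))) * exp (- (s * of_real t))"
        by (simp add: algebra_simps flip: exp_of_real exp_add)
      then show ?thesis by (simp add: B_def)
    qed
    then show ?thesis by (simp add: laplace_def)
  qed
  have pd: "laplace_conv (powr_density \<beta>) 0" using b by (intro laplace_conv_powr_density) auto
  have fconv: "laplace_conv f 0"
    unfolding laplace_conv_def
  proof (intro conjI allI impI)
    have [measurable]: "powr_density \<beta> \<in> borel_measurable borel" using pd by (simp add: laplace_conv_def)
    show m[measurable]: "f \<in> borel_measurable borel" unfolding f_def B_def by measurable
    fix e :: real assume e: "e > 0"
    have "integrable lborel (\<lambda>t. f t * exp (- (of_real e * of_real t)))"
      using laplace_integrable[OF Bconv, of "of_real e"] laplace_integrable[OF pd, of "of_real e"] e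
      by (simp add: f_def left_diff_distrib mult.assoc)
    then have "integrable lborel (\<lambda>t. norm (f t * exp (- (of_real e * of_real t))))" by (rule integrable_norm)
    then show "integrable lborel (\<lambda>t. norm (f t) * exp (- (e * t)))" by (simp add: norm_mult)
  qed (simp add: f_def B_def zero powr_density_def)
  have flap: "laplace f s = laplace (\<lambda>t. of_real (W t)) (s + of_real a) - c * s powr (- \<beta>)" if "Re s > 0" for s
  proof -
    have "laplace f s = laplace (\<lambda>t. of_real (B t)) s - L * laplace (powr_density \<beta>) s"
      using laplace_integrable[OF Bconv that] laplace_integrable[OF pd that]
      unfolding laplace_def f_def by (simp add: left_diff_distrib mult.assoc)
    then show ?thesis using laplace_powr_density[of \<beta> s] that b G0 by (simp add: Blap L_def)
  qed
  \<comment> \<open>Away from \<open>0\<close> the continuation is bounded by compactness and the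
    model term by \<open>norm_powr_le\<close>. The bound is uniform for nearby ordinates, so it also
    serves in \<open>near'\<close>.\<close>
  have away': "\<exists>r>0. \<exists>K\<ge>0. \<forall>e \<eta>'. 0 < e \<and> e < r \<and> \<bar>\<eta>' - \<eta>\<bar> < r \<longrightarrow> norm (laplace f (Complex e \<eta>')) \<le> K"
    if \<eta>: "\<eta> \<noteq> 0" for \<eta>
  proof -
    have "continues_at (laplace (\<lambda>t. of_real (W t))) a (Complex a \<eta>)"
      using \<eta> by (intro away) (auto simp: complex_eq_iff)
    then obtain r G where r: "r > 0" "G holomorphic_on ball (Complex a \<eta>) r"
       "\<And>w. w \<in> ball (Complex a \<eta>) r \<Longrightarrow> Re w > a \<Longrightarrow> laplace (\<lambda>t. of_real (W t)) w = G w"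
      by (auto simp: continues_at_def)
    obtain K where K: "K \<ge> 0" "\<And>w. w \<in> cball (Complex a \<eta>) (r / 2) \<Longrightarrow> norm (G w) \<le> K"
      using holomorphic_bounded_near[OF r(2,1)] by blast
    define K' where "K' = norm c * ((\<bar>\<eta>\<bar> / 2) powr (- b) * exp (pi * \<bar>Im \<beta>\<bar>))"
    \<comment> \<open>The first entry keeps the shifted point within half the radius of
      continuation, the second keeps \<open>\<eta>'\<close> at distance at least
      \<open>\<bar>\<eta>\<bar> / 2\<close> from \<open>0\<close>.\<close>
    define d where "d = min (r / 4) (\<bar>\<eta>\<bar> / 2)"
    have "norm (laplace f (Complex e \<eta>')) \<le> K + K'" if "0 < e" "e < d" "\<bar>\<eta>' - \<eta>\<bar> < d" for e \<eta>'
    proof -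
      let ?s = "Complex e \<eta>'"
      have "dist (Complex a \<eta>) (?s + of_real a) \<le> \<bar>e\<bar> + \<bar>\<eta>' - \<eta>\<bar>"
        unfolding dist_norm by (rule order_trans[OF cmod_le]) simp
      then have "dist (Complex a \<eta>) (?s + of_real a) \<le> r / 2" using that by (auto simp: d_def)
      then have 1: "norm (laplace (\<lambda>t. of_real (W t)) (?s + of_real a)) \<le> K"
        using r K that by (subst r(3)) auto
      have "\<bar>\<eta>' - \<eta>\<bar> < \<bar>\<eta>\<bar> / 2" using that by (simp add: d_def)
      then have "\<bar>\<eta>\<bar> / 2 \<le> \<bar>\<eta>'\<bar>" by linarith
      also have "\<dots> \<le> norm ?s" using abs_Im_le_cmod[of ?s] by simp
      finally have n: "\<bar>\<eta>\<bar> / 2 \<le> norm ?s" .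
      have "norm (?s powr (- \<beta>)) \<le> norm ?s powr (- b) * exp (pi * \<bar>Im \<beta>\<bar>)"
        using norm_powr_le[of ?s "- \<beta>"] that by (simp add: b_def complex_eq_iff)
      also have "\<dots> \<le> (\<bar>\<eta>\<bar> / 2) powr (- b) * exp (pi * \<bar>Im \<beta>\<bar>)"
        using n \<eta> b1 by (intro mult_right_mono powr_mono2') auto
      finally have 2: "norm (c * ?s powr (- \<beta>)) \<le> K'"
        unfolding K'_def norm_mult by (rule mult_left_mono) auto
      show ?thesis using 1 2 that norm_triangle_ineq4[of "laplace (\<lambda>t. of_real (W t)) (?s + of_real a)" "c * ?s powr (- \<beta>)"]
        by (subst flap) auto
    qed
    moreover have "d > 0" using r \<eta> by (simp add: d_def)
    moreover have "K + K' \<ge> 0" using K by (simp add: K'_def)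
    ultimately show ?thesis by blast
  qed
  have near': "\<exists>r>0. \<exists>K. \<forall>e \<eta>'. 0 < e \<and> e < r \<and> \<bar>\<eta>' - \<eta>\<bar> < r \<longrightarrow> norm (laplace f (Complex e \<eta>')) \<le> K * e powr (1 - b)" for \<eta>
  proof (cases "\<eta> = 0")
    case False
    then obtain r K where rK: "r > 0" "K \<ge> 0"
      "\<And>e \<eta>'. 0 < e \<Longrightarrow> e < r \<Longrightarrow> \<bar>\<eta>' - \<eta>\<bar> < r \<Longrightarrow> norm (laplace f (Complex e \<eta>')) \<le> K"
      using away' by meson
    have "norm (laplace f (Complex e \<eta>')) \<le> K * e powr (1 - b)"
      if "0 < e" "e < min r 1" "\<bar>\<eta>' - \<eta>\<bar> < min r 1" for e \<eta>'
    proof -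
      have "1 powr (1 - b) \<le> e powr (1 - b)" using that b1 by (intro powr_mono2') auto
      then have "K * 1 \<le> K * e powr (1 - b)" using rK(2) by (intro mult_left_mono) auto
      then show ?thesis using rK(3)[of e \<eta>'] that by simp
    qed
    moreover have "min r 1 > 0" using rK(1) by simp
    ultimately show ?thesis by blast
  next
    case True
    obtain r G H where r: "r > 0" "G holomorphic_on ball (of_real a) r" "H holomorphic_on ball (of_real a) r"
      "H (of_real a) = c"
      "\<And>w. w \<in> ball (of_real a) r \<Longrightarrow> Re w > a \<Longrightarrow>
         laplace (\<lambda>t. of_real (W t)) w = G w + H w * (w - of_real a) powr (- \<beta>)"
      using near by (auto simp: powr_singularity_def)
    obtain K1 where K1: "K1 \<ge> 0" "\<And>w. w \<in> cball (of_real a) (r / 2) \<Longrightarrow> norm (G w) \<le> K1"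
      using holomorphic_bounded_near[OF r(2,1)] by blast
    \<comment> \<open>The removable quotient of \<open>H w - c\<close> by
      \<open>w - of_real a\<close>. Subtracting the model thus leaves one extra factor
      \<open>s\<close>, which improves the exponent \<open>- b\<close> to
      \<open>1 - b\<close>.\<close>
    let ?R = "\<lambda>w. if w = of_real a then deriv H (of_real a) else (H w - H (of_real a)) / (w - of_real a)"
    have "?R holomorphic_on ball (of_real a) r"
      using r by (intro pole_lemma) auto
    then obtain K2 where K2: "K2 \<ge> 0" "\<And>w. w \<in> cball (of_real a) (r / 2) \<Longrightarrow> norm (?R w) \<le> K2"
      using holomorphic_bounded_near[OF _ r(1)] by blast
    define K where "K = K1 + K2 * exp (pi * \<bar>Im \<beta>\<bar>)"
    have "norm (laplace f (Complex e \<eta>')) \<le> K * e powr (1 - b)" if "0 < e" "e < min (r / 4) 1" "\<bar>\<eta>'\<bar> < min (r / 4) 1" for e \<eta>'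
    proof -
      let ?s = "Complex e \<eta>'"
      let ?w = "?s + of_real a"
      have s0: "?s \<noteq> 0" using that by (simp add: complex_eq_iff)
      have "dist (of_real a) ?w \<le> \<bar>e\<bar> + \<bar>\<eta>'\<bar>"
        using cmod_le[of ?s] by (simp add: dist_norm)
      then have w: "?w \<in> cball (of_real a) (r / 2)" using that by auto
      have "laplace f ?s = G ?w + (H ?w - c) * ?s powr (- \<beta>)"
        using that w r(1) by (subst flap, simp, subst r(5)) (auto simp: left_diff_distrib)
      also have "H ?w - c = ?R ?w * ?s" using s0 r(4) by simp
      finally have "norm (laplace f ?s) \<le> norm (G ?w) + norm (?R ?w) * (norm ?s * norm (?s powr (- \<beta>)))"
        by (simp only:) (rule order_trans[OF norm_triangle_ineq], simp add: norm_mult)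
      also have "norm (G ?w) \<le> K1" using w by (rule K1)
      also have "norm (?R ?w) * (norm ?s * norm (?s powr (- \<beta>))) \<le> K2 * (e powr (1 - b) * exp (pi * \<bar>Im \<beta>\<bar>))"
      proof (rule mult_mono)
        have "norm ?s * norm (?s powr (- \<beta>)) \<le> norm ?s * (norm ?s powr (- b) * exp (pi * \<bar>Im \<beta>\<bar>))"
          using norm_powr_le[OF s0, of "- \<beta>"] by (intro mult_left_mono) (auto simp: b_def)
        also have "\<dots> = norm ?s powr (1 - b) * exp (pi * \<bar>Im \<beta>\<bar>)"
          using s0 by (simp add: powr_diff powr_minus_divide)
        also have "\<dots> \<le> e powr (1 - b) * exp (pi * \<bar>Im \<beta>\<bar>)"
          using that b1 abs_Re_le_cmod[of ?s] by (intro mult_right_mono powr_mono2') auto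
        finally show "norm ?s * norm (?s powr (- \<beta>)) \<le> e powr (1 - b) * exp (pi * \<bar>Im \<beta>\<bar>)" .
        show "norm (?R ?w) \<le> K2" using w by (rule K2)
      qed (use K2(1) in auto)
      also have "K1 \<le> K1 * e powr (1 - b)"
      proof -
        have "1 powr (1 - b) \<le> e powr (1 - b)" using that b1 by (intro powr_mono2') auto
        then show ?thesis using K1(1) mult_left_mono[of 1 "e powr (1 - b)" K1] by simp
      qed
      finally show ?thesis by (simp add: K_def algebra_simps)
    qed
    moreover have "min (r / 4) 1 > 0" using r(1) by simp
    ultimately show ?thesis unfolding True diff_0_right by blast
  qed
  define I where "I l x = (\<integral>t. B t * exp (- (t / x)) * fejer (l * (x - t)) \<partial>lborel)" for l x
  \<comment> \<open>The unimodular phase that separates \<open>x powr (1 - \<beta>)\<close> from its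
    modulus \<open>x powr (1 - b)\<close>.\<close>
  define u where "u x = complex_of_real x powr (- (\<i> * of_real (Im \<beta>)))" for x :: real
  have u1: "norm (u x) = 1" if "x > 0" for x
    using that by (simp add: u_def norm_powr_real_powr)
  have xu: "complex_of_real x powr (1 - \<beta>) = of_real (x powr (1 - b)) * u x" if "x > 0" for x
  proof -
    have "1 - \<beta> = of_real (1 - b) + - (\<i> * of_real (Im \<beta>))" by (simp add: complex_eq_iff b_def)
    then have "complex_of_real x powr (1 - \<beta>) = of_real x powr of_real (1 - b) * u x"
      unfolding u_def by (simp only: powr_add)
    then show ?thesis using powr_of_real[of x "1 - b"] that by (simp only: less_imp_le)
  qed
  have Bk: "integrable lborel (\<lambda>t. B t * exp (- (t / x)) * fejer (l * (x - t)))" if "x > 0" for x l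
    using integrable_mult_fejer[OF Bint[of "1 / x"]] that by simp
  \<comment> \<open>The average of \<open>f\<close> tends to \<open>0\<close> after normalisation;
    adding back \<open>L\<close> times the average of the model gives the limit for
    \<open>B\<close>.\<close>
  have Ilim: "((\<lambda>x. of_real (x powr (1 - b) * I l x) * u x) \<longlongrightarrow> L * of_real (exp (-1) * fejer_mass / l)) at_top"
    if l: "l > 0" for l
  proof -
    let ?Z = "\<lambda>x. \<integral>t. f t * exp (- (of_real (1 / x) * of_real t)) * of_real (fejer (l * (x - t))) \<partial>lborel"
    let ?P = "\<lambda>x. \<integral>t. powr_density \<beta> t * exp (- (of_real (1 / x) * of_real t)) * of_real (fejer (l * (x - t))) \<partial>lborel"
    have "((\<lambda>x. of_real (x powr (1 - b)) * ?Z x) \<longlongrightarrow> 0) at_top"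
    proof (rule fejer_laplace_tendsto_0[OF fconv b1 l near'])
      fix \<eta> :: real assume "\<eta> \<noteq> 0"
      then obtain r K where rK: "r > 0"
        "\<And>e \<eta>'. 0 < e \<Longrightarrow> e < r \<Longrightarrow> \<bar>\<eta>' - \<eta>\<bar> < r \<Longrightarrow> norm (laplace f (Complex e \<eta>')) \<le> K"
        using away' by meson
      have "norm (laplace f (Complex e \<eta>)) \<le> K" if "0 < e" "e < r" for e
        using rK(2)[OF that, of \<eta>] rK(1) by simp
      then show "\<exists>r>0. \<exists>K. \<forall>e. 0 < e \<and> e < r \<longrightarrow> norm (laplace f (Complex e \<eta>)) \<le> K"
        using rK(1) by blast
    qed
    then have "((\<lambda>x. norm (of_real (x powr (1 - b)) * ?Z x)) \<longlongrightarrow> 0) at_top"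
      by (rule tendsto_norm_zero)
    then have "((\<lambda>x. norm (of_real x powr (1 - \<beta>) * ?Z x)) \<longlongrightarrow> 0) at_top"
      by (rule Lim_transform_eventually)
         (use eventually_gt_at_top[of 0] in eventually_elim, simp add: xu u1 norm_mult)
    then have "((\<lambda>x. of_real x powr (1 - \<beta>) * ?Z x + L * (of_real x powr (1 - \<beta>) * ?P x)) \<longlongrightarrow>
         0 + L * of_real (exp (-1) * fejer_mass / l)) at_top"
      by (intro tendsto_add tendsto_mult_left powr_density_fejer_limit b l) (rule tendsto_norm_zero_cancel)
    then have "((\<lambda>x. of_real x powr (1 - \<beta>) * ?Z x + L * (of_real x powr (1 - \<beta>) * ?P x)) \<longlongrightarrow>
         L * of_real (exp (-1) * fejer_mass / l)) at_top" by simp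
    then show ?thesis
    proof (rule Lim_transform_eventually)
      show "\<forall>\<^sub>F x in at_top. of_real x powr (1 - \<beta>) * ?Z x + L * (of_real x powr (1 - \<beta>) * ?P x) =
         of_real (x powr (1 - b) * I l x) * u x"
        using eventually_gt_at_top[of 0]
      proof eventually_elim
        case (elim x)
        have ee: "exp (- (complex_of_real (1 / x) * of_real t)) = of_real (exp (- (t / x)))" for t
          by (simp flip: exp_of_real)
        have pint: "integrable lborel (\<lambda>t. powr_density \<beta> t * exp (- (of_real (1 / x) * of_real t)) * of_real (fejer (l * (x - t))))"
          using laplace_integrable[OF pd, of "of_real (1 / x)"] elim by (intro integrable_mult_fejer) simp
        have bint: "integrable lborel (\<lambda>t. complex_of_real (B t * exp (- (t / x)) * fejer (l * (x - t))))"
          using Bk[OF elim] by (rule integrable_of_real)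
        have "?Z x = (\<integral>t. complex_of_real (B t * exp (- (t / x)) * fejer (l * (x - t))) -
            L * (powr_density \<beta> t * exp (- (of_real (1 / x) * of_real t)) * of_real (fejer (l * (x - t)))) \<partial>lborel)"
          by (intro Bochner_Integration.integral_cong refl)
             (simp only: f_def left_diff_distrib ee mult.assoc of_real_mult)
        also have "\<dots> = of_real (I l x) - L * ?P x"
          using pint bint by (simp only: Bochner_Integration.integral_diff integrable_mult_right integral_mult_right_zero I_def integral_complex_of_real)
        finally show ?case using xu[OF elim] by (simp only:) (simp add: algebra_simps)
      qed
    qed
  qed
  have I0: "I l x \<ge> 0" for l x
    unfolding I_def B_def by (intro integral_nonneg_AE AE_I2) (simp add: W0 fejer_nonneg)
  have Ilim': "((\<lambda>x. x powr (1 - b) * I l x) \<longlongrightarrow> norm L * (exp (-1) * fejer_mass / l)) at_top"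
    if l: "l > 0" for l
  proof -
    have "((\<lambda>x. norm (of_real (x powr (1 - b) * I l x) * u x)) \<longlongrightarrow> norm (L * of_real (exp (-1) * fejer_mass / l))) at_top"
      by (rule tendsto_norm[OF Ilim[OF l]])
    also have "norm (L * of_real (exp (-1) * fejer_mass / l)) = norm L * (exp (-1) * fejer_mass / l)"
      using fejer_mass_pos l unfolding norm_mult norm_of_real by simp
    finally show ?thesis
      by (rule Lim_transform_eventually)
         (use eventually_gt_at_top[of 0] in eventually_elim, simp add: u1 norm_mult I0)
  qed
  have Blim: "((\<lambda>x. x powr (1 - b) * B x) \<longlongrightarrow> norm L) at_top"
  proof (rule fejer_tauberian[where a=a])
    fix x y :: real assume "x \<le> y"
    then have "W x * exp (- (a * y)) \<le> W y * exp (- (a * y))" using monoD[OF mono] by (intro mult_right_mono) auto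
    then show "B x * exp (- (a * (y - x))) \<le> B y"
      by (simp add: B_def mult_ac algebra_simps flip: exp_add)
  qed (use Bk Ilim' b1 a in \<open>auto simp: I_def B_def W0 zero\<close>)
  \<comment> \<open>Chosen so that \<open>k\<close> times the constant in \<open>Ilim\<close> for
    \<open>l = 1\<close> is \<open>1\<close>. Then \<open>B x\<close> minus \<open>k\<close> times
    its average is negligible, and multiplying by the phase and adding \<open>Ilim\<close> yields
    the complex limit \<open>L\<close>.\<close>
  define k where "k = exp 1 / fejer_mass"
  have k: "exp (-1) * fejer_mass / 1 * k = 1" using fejer_mass_pos by (simp add: k_def exp_minus)
  have "((\<lambda>x. x powr (1 - b) * B x - x powr (1 - b) * I 1 x * k) \<longlongrightarrow> norm L - norm L * (exp (-1) * fejer_mass / 1) * k) at_top"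
    by (intro tendsto_diff Blim tendsto_mult_right Ilim') simp
  also have "norm L - norm L * (exp (-1) * fejer_mass / 1) * k = 0"
    using k by (simp only: mult.assoc mult_1_right diff_self)
  finally have Z: "((\<lambda>x. x powr (1 - b) * B x - x powr (1 - b) * I 1 x * k) \<longlongrightarrow> 0) at_top" .
  have "((\<lambda>x. complex_of_real (x powr (1 - b) * B x - x powr (1 - b) * I 1 x * k) * u x) \<longlongrightarrow> 0) at_top"
  proof (rule tendsto_norm_zero_cancel, rule Lim_transform_eventually[OF tendsto_norm_zero[OF Z]])
    show "\<forall>\<^sub>F x in at_top. norm (x powr (1 - b) * B x - x powr (1 - b) * I 1 x * k) =
        norm (complex_of_real (x powr (1 - b) * B x - x powr (1 - b) * I 1 x * k) * u x)"
      using eventually_gt_at_top[of 0]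
      by eventually_elim (simp only: norm_mult u1 norm_of_real real_norm_def mult_1_right)
  qed
  moreover have "((\<lambda>x. of_real (x powr (1 - b) * I 1 x) * u x * of_real k) \<longlongrightarrow> L * of_real (exp (-1) * fejer_mass / 1) * of_real k) at_top"
    by (intro tendsto_mult_right Ilim) simp
  ultimately have "((\<lambda>x. complex_of_real (x powr (1 - b) * B x - x powr (1 - b) * I 1 x * k) * u x +
      of_real (x powr (1 - b) * I 1 x) * u x * of_real k) \<longlongrightarrow> 0 + L * of_real (exp (-1) * fejer_mass / 1) * of_real k) at_top"
    by (rule tendsto_add)
  also have "0 + L * of_real (exp (-1) * fejer_mass / 1) * of_real k = L"
    using k by (simp only: mult.assoc of_real_1 mult_1_right add_0 flip: of_real_mult)
  finally show ?thesis
    unfolding L_def[symmetric]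
  proof (rule Lim_transform_eventually)
    show "\<forall>\<^sub>F x in at_top. complex_of_real (x powr (1 - b) * B x - x powr (1 - b) * I 1 x * k) * u x +
      of_real (x powr (1 - b) * I 1 x) * u x * of_real k = of_real (exp (- (a * x)) * W x) * of_real x powr (1 - \<beta>)"
      using eventually_gt_at_top[of 0]
      by eventually_elim (simp add: xu B_def algebra_simps)
  qed
qed

subsection \<open>Monotone functions and counting functions\<close>

lemma continues_at_deriv:
  assumes "continues_at \<Psi> a s" and d: "\<And>w. Re w > a \<Longrightarrow> (\<Psi> has_field_derivative - \<Psi>' w) (at w)"
  shows "continues_at \<Psi>' a s"
proof -
  obtain r G where r: "r > 0" "G holomorphic_on ball s r" "\<And>w. w \<in> ball s r \<Longrightarrow> Re w > a \<Longrightarrow> \<Psi> w = G w"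
    using assms(1) by (auto simp: continues_at_def)
  have "\<Psi>' w = - deriv G w" if w: "w \<in> ball s r" "Re w > a" for w
  proof -
    have "(\<Psi> has_field_derivative deriv G w) (at w)"
    proof (rule has_field_derivative_transform_within_open)
      show "(G has_field_derivative deriv G w) (at w)"
        using r w by (intro holomorphic_derivI) auto
      show "open (ball s r \<inter> {w. Re w > a})" by (intro open_Int open_halfspace_Re_gt) auto
    qed (use r w in auto)
    from DERIV_unique[OF d[OF w(2)] this] show ?thesis by (metis minus_minus)
  qed
  moreover have "(\<lambda>w. - deriv G w) holomorphic_on ball s r"
    using r by (intro holomorphic_intros) auto
  ultimately show ?thesis using r(1) unfolding continues_at_def by blast
qed

text \<open>By the product rule, minus the derivative of
  \<open>H w * (w - of_real a) powr (- \<beta>)\<close> is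
  \<open>H' w * (w - of_real a) powr (- (\<beta> + 1))\<close>. The term of \<open>H'\<close>
  containing \<open>deriv H\<close> vanishes at the centre, so the new leading constant is
  \<open>\<beta> * c\<close>.\<close>

lemma powr_singularity_deriv:
  assumes "powr_singularity \<Psi> a \<beta> c" and d: "\<And>w. Re w > a \<Longrightarrow> (\<Psi> has_field_derivative - \<Psi>' w) (at w)"
  shows "powr_singularity \<Psi>' a (\<beta> + 1) (\<beta> * c)"
proof -
  let ?B = "ball (complex_of_real a)"
  obtain r G H where r: "r > 0" "G holomorphic_on ?B r" "H holomorphic_on ?B r"
      "H (of_real a) = c"
      "\<And>w. w \<in> ?B r \<Longrightarrow> Re w > a \<Longrightarrow> \<Psi> w = G w + H w * (w - of_real a) powr (- \<beta>)"
    using assms(1) by (auto simp: powr_singularity_def)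
  define H' where "H' w = \<beta> * H w - (w - of_real a) * deriv H w" for w
  have eq: "\<Psi>' w = - deriv G w + H' w * (w - of_real a) powr (- (\<beta> + 1))" if w: "w \<in> ?B r" "Re w > a" for w
  proof -
    let ?u = "w - of_real a"
    have u: "?u \<notin> \<real>\<^sub>\<le>\<^sub>0" "?u \<noteq> 0" using w by (auto simp: complex_nonpos_Reals_iff)
    have "(\<Psi> has_field_derivative deriv G w + (deriv H w * ?u powr (- \<beta>) + H w * (- \<beta> * ?u powr (- \<beta> - 1)))) (at w)"
    proof (rule has_field_derivative_transform_within_open)
      have G: "(G has_field_derivative deriv G w) (at w)" and H: "(H has_field_derivative deriv H w) (at w)"
        using r w by (auto intro!: holomorphic_derivI)
      show "((\<lambda>w. G w + H w * (w - of_real a) powr (- \<beta>)) has_field_derivative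
          deriv G w + (deriv H w * ?u powr (- \<beta>) + H w * (- \<beta> * ?u powr (- \<beta> - 1)))) (at w)"
        using u by (auto intro!: derivative_eq_intros G H has_field_derivative_powr)
      show "open (?B r \<inter> {w. Re w > a})" by (intro open_Int open_halfspace_Re_gt) auto
    qed (use r w in auto)
    from DERIV_unique[OF d[OF w(2)] this] have "\<Psi>' w = - (deriv G w + (deriv H w * ?u powr (- \<beta>) + H w * (- \<beta> * ?u powr (- \<beta> - 1))))"
      by (metis minus_minus)
    also have "?u powr (- \<beta>) = ?u * ?u powr (- \<beta> - 1)" using u by (simp add: powr_diff)
    finally have "\<Psi>' w = - deriv G w + H' w * ?u powr (- \<beta> - 1)"
      by (simp add: H'_def algebra_simps)
    moreover have "- (\<beta> + 1) = - \<beta> - 1" by simp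
    ultimately show ?thesis by (simp only:)
  qed
  have "(\<lambda>w. - deriv G w) holomorphic_on ?B r" "H' holomorphic_on ?B r"
    unfolding H'_def using r by (auto intro!: holomorphic_intros)
  moreover have "H' (of_real a) = \<beta> * c" using r by (simp add: H'_def)
  ultimately show ?thesis using r(1) eq unfolding powr_singularity_def by blast
qed

lemma laplace_conv_power:
  assumes "laplace_conv f a"
  shows "laplace_conv (\<lambda>t. of_real t ^ k * f t) a"
proof (induction k)
  case (Suc k)
  then show ?case using laplace_conv_times[OF Suc] by (simp add: mult.assoc)
qed (use assms in simp)

lemma laplace_power_derivative:
  assumes "laplace_conv f a" "Re s > a"
  shows "(laplace (\<lambda>t. of_real t ^ k * f t) has_field_derivative - laplace (\<lambda>t. of_real t ^ Suc k * f t) s) (at s)"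
  using laplace_has_derivative[OF laplace_conv_power[OF assms(1), of k] assms(2)] by (simp add: mult.assoc)

lemma continues_at_laplace_power:
  assumes "laplace_conv f a" "continues_at (laplace f) a s"
  shows "continues_at (laplace (\<lambda>t. of_real t ^ k * f t)) a s"
proof (induction k)
  case (Suc k)
  then show ?case by (rule continues_at_deriv) (rule laplace_power_derivative[OF assms(1)])
qed (use assms in simp)

text \<open>The factors \<open>\<beta>\<close>, \<open>\<beta> + 1\<close>, and so on produced by
  successive differentiations accumulate to a Pochhammer symbol.\<close>

lemma powr_singularity_laplace_power:
  assumes "laplace_conv f a" "powr_singularity (laplace f) a \<beta> c"
  shows "powr_singularity (laplace (\<lambda>t. of_real t ^ k * f t)) a (\<beta> + of_nat k) (pochhammer \<beta> k * c)"
proof (induction k)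
  case (Suc k)
  have "powr_singularity (laplace (\<lambda>t. of_real t ^ Suc k * f t)) a (\<beta> + of_nat k + 1) ((\<beta> + of_nat k) * (pochhammer \<beta> k * c))"
    using Suc by (rule powr_singularity_deriv) (rule laplace_power_derivative[OF assms(1)])
  then show ?case by (simp add: pochhammer_Suc algebra_simps)
qed (use assms in simp)

text \<open>Multiplying \<open>N\<close> by \<open>t ^ k\<close> differentiates the transform \<open>k\<close> times and raises the exponent
  \<open>\<beta>\<close> by \<open>k\<close>, which reduces the claim to the case \<open>Re \<beta> > 1\<close>.\<close>

lemma laplace_tauberian_monotone:
  fixes N :: "real \<Rightarrow> real"
  assumes mono: "mono N" and zero: "\<And>t. t < 0 \<Longrightarrow> N t = 0"
    and conv: "laplace_conv (\<lambda>t. of_real (N t)) a" and a: "a \<ge> 0" and \<beta>: "\<beta> \<notin> \<int>\<^sub>\<le>\<^sub>0"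
    and away: "\<And>s. Re s = a \<Longrightarrow> s \<noteq> of_real a \<Longrightarrow> continues_at (laplace (\<lambda>t. of_real (N t))) a s"
    and near: "powr_singularity (laplace (\<lambda>t. of_real (N t))) a \<beta> c"
  shows "((\<lambda>x. of_real (exp (- (a * x)) * N x) * of_real x powr (1 - \<beta>)) \<longlongrightarrow> c / Gamma \<beta>) at_top"
proof -
  obtain k :: nat where k: "1 - Re \<beta> < of_nat k" using reals_Archimedean2 by blast
  have N0: "N t \<ge> 0" for t
    using zero[of "min t 0 - 1"] monoD[OF mono, of "min t 0 - 1" t] by auto
  define W where "W t = t ^ k * N t" for t
  have W: "complex_of_real (W t) = of_real t ^ k * of_real (N t)" for t by (simp add: W_def)
  have "mono W"
  proof (rule monoI)
    fix x y :: real assume xy: "x \<le> y"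
    show "W x \<le> W y"
    \<comment> \<open>The power \<open>t ^ k\<close> need not be monotone for negative
      \<open>t\<close>, but \<open>N\<close> vanishes there.\<close>
    proof (cases "x < 0")
      case True
      then show ?thesis using N0[of y] zero[of y] by (cases "y < 0") (auto simp: W_def zero)
    next
      case False
      then show ?thesis unfolding W_def using xy N0 monoD[OF mono xy] by (intro mult_mono power_mono) auto
    qed
  qed
  then have "((\<lambda>x. of_real (exp (- (a * x)) * W x) * of_real x powr (1 - (\<beta> + of_nat k))) \<longlongrightarrow>
     pochhammer \<beta> k * c / Gamma (\<beta> + of_nat k)) at_top"
  proof (rule laplace_tauberian)
    show "laplace_conv (\<lambda>t. of_real (W t)) a" unfolding W by (rule laplace_conv_power[OF conv])
    show "continues_at (laplace (\<lambda>t. of_real (W t))) a s" if "Re s = a" "s \<noteq> of_real a" for s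
      unfolding W by (rule continues_at_laplace_power[OF conv away[OF that]])
    show "powr_singularity (laplace (\<lambda>t. of_real (W t))) a (\<beta> + of_nat k) (pochhammer \<beta> k * c)"
      unfolding W by (rule powr_singularity_laplace_power[OF conv near])
  qed (use k a in \<open>auto simp: W_def zero\<close>)
  \<comment> \<open>The Pochhammer symbol is
    \<open>Gamma (\<beta> + of_nat k) / Gamma \<beta>\<close>, as \<open>\<beta>\<close> is not a
    pole; hence the shift by \<open>k\<close> disappears from the constant.\<close>
  also have "pochhammer \<beta> k * c / Gamma (\<beta> + of_nat k) = c / Gamma \<beta>"
  proof -
    have "\<beta> + of_nat k \<notin> \<int>\<^sub>\<le>\<^sub>0" using k by (auto elim!: nonpos_Ints_cases simp: complex_eq_iff)
    then have "Gamma (\<beta> + of_nat k) \<noteq> 0" by (simp add: Gamma_eq_zero_iff)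
    then show ?thesis using pochhammer_Gamma[OF \<beta>, of k] by simp
  qed
  finally show ?thesis
  proof (rule Lim_transform_eventually)
    show "\<forall>\<^sub>F x in at_top. of_real (exp (- (a * x)) * W x) * of_real x powr (1 - (\<beta> + of_nat k)) =
       of_real (exp (- (a * x)) * N x) * of_real x powr (1 - \<beta>)"
      using eventually_gt_at_top[of 0]
    proof eventually_elim
      case (elim x)
      have "complex_of_real x powr (1 - (\<beta> + of_nat k)) = of_real x powr (1 - \<beta>) / of_real x powr of_nat k"
        by (simp add: algebra_simps flip: powr_diff)
      also have "complex_of_real x powr of_nat k = of_real x ^ k" using elim by (simp add: powr_nat')
      finally show ?case using elim by (simp add: W_def)
    qed
  qed
qed

lemma exp_tail_integral:
  assumes "Re s > 0"
  shows "integrable lborel (\<lambda>t. indicator {\<tau>..} t * exp (- (s * of_real t)))"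
    and "(\<integral>t. indicator {\<tau>..} t * exp (- (s * of_real t)) \<partial>lborel) = exp (- (of_real \<tau> * s)) / s"
proof -
  let ?g = "\<lambda>t. powr_density 1 t * exp (- (s * of_real t))"
  have [measurable]: "powr_density 1 \<in> borel_measurable borel"
    unfolding powr_density_def powr_def by measurable
  have i: "integrable lborel ?g"
    using laplace_integrable[OF laplace_conv_powr_density[of 1]] assms by simp
  have v: "integral\<^sup>L lborel ?g = 1 / s"
    using laplace_powr_density[of 1 s] assms by (auto simp: laplace_def powr_minus_divide)
  \<comment> \<open>\<open>powr_density 1\<close> is the indicator of the positive half-line, with
    transform \<open>1 / s\<close>. Translating it by \<open>\<tau>\<close> gives the tail indicator
    except at the endpoint, a null set.\<close>
  have ae: "AE t in lborel. indicator {\<tau>..} t * exp (- (s * of_real t)) = exp (- (of_real \<tau> * s)) * ?g (- \<tau> + 1 * t)"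
    using AE_lborel_singleton[of \<tau>]
  proof eventually_elim
    case (elim t)
    have "exp (- (of_real \<tau> * s)) * exp (- (s * of_real (- \<tau> + 1 * t))) = exp (- (s * of_real t))"
      by (simp flip: exp_add add: algebra_simps)
    then show ?case using elim by (auto simp: powr_density_def indicator_def)
  qed
  have i': "integrable lborel (\<lambda>t. exp (- (of_real \<tau> * s)) * ?g (- \<tau> + 1 * t))"
    by (intro integrable_mult_right lborel_integrable_real_affine[OF i]) simp
  show "integrable lborel (\<lambda>t. indicator {\<tau>..} t * exp (- (s * of_real t)))"
    by (rule integrable_cong_AE_imp[OF i']) (use ae in \<open>auto simp: eq_commute\<close>)
  have "(\<integral>t. indicator {\<tau>..} t * exp (- (s * of_real t)) \<partial>lborel) =
      (\<integral>t. exp (- (of_real \<tau> * s)) * ?g (- \<tau> + 1 * t) \<partial>lborel)"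
    by (rule integral_cong_AE[OF _ _ ae]) measurable
  also have "\<dots> = exp (- (of_real \<tau> * s)) * integral\<^sup>L lborel ?g"
    using lborel_integral_real_affine[of 1 ?g "- \<tau>"] by simp
  finally show "(\<integral>t. indicator {\<tau>..} t * exp (- (s * of_real t)) \<partial>lborel) = exp (- (of_real \<tau> * s)) / s"
    by (simp add: v)
qed

text \<open>Sizes are nonnegative and have no accumulation point, so only finitely many lie in the
  compact interval from \<open>0\<close> to \<open>x\<close>, each with finitely many
  objects.\<close>

lemma finite_upto:
  assumes "combinatorial_class C sz"
  shows "finite {c \<in> C. sz c \<le> x}"
proof -
  have "finite ({0..x} \<inter> sz ` C)"
    using assms by (intro finite_not_islimpt_in_compact) (auto simp: combinatorial_class_def)
  then have "finite (\<Union>l\<in>{0..x} \<inter> sz ` C. {c \<in> C. sz c = l})"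
    using assms by (intro finite_UN_I) (auto simp: combinatorial_class_def)
  then show ?thesis
    by (rule rev_finite_subset) (use assms in \<open>auto simp: combinatorial_class_def\<close>)
qed

text \<open>\<open>N\<close> is the sum over the objects of the indicators of
  \<open>t \<ge> sz c\<close>, each with transform \<open>exp (- (of_real (sz c) * s)) / s\<close>.
  The sum is truncated to sizes at most \<open>n\<close>. Monotone convergence on the real axis
  gives integrability of the limit, and dominated convergence then gives the formula for complex
  \<open>s\<close>.\<close>

lemma laplace_counting:
  fixes C :: "'a set" and sz :: "'a \<Rightarrow> real"
  defines "N \<equiv> \<lambda>t. real (card {c \<in> C. sz c \<le> t})"
  assumes C: "combinatorial_class C sz" and a: "a \<ge> 0"
    and summable: "\<And>\<sigma>. \<sigma> > a \<Longrightarrow> (\<lambda>c. exp (- (sz c * \<sigma>))) summable_on C"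
  shows "laplace_conv (\<lambda>t. of_real (N t)) a"
    and "Re s > a \<Longrightarrow> laplace (\<lambda>t. of_real (N t)) s = dirichlet_gf C sz s / s"
proof -
  define A where "A n = {c \<in> C. sz c \<le> real n}" for n :: nat
  define M where "M n t = real (card {c \<in> A n. sz c \<le> t})" for n t
  have fin: "finite {c \<in> C. sz c \<le> x}" "finite (A n)" for x n
    using finite_upto[OF C] by (auto simp: A_def)
  have M_sum: "complex_of_real (M n t) = (\<Sum>c\<in>A n. indicator {sz c..} t)" for n t
  proof -
    have "complex_of_real (M n t) = (\<Sum>c\<in>{c\<in>A n. sz c \<le> t}. 1)" by (simp add: M_def)
    also have "\<dots> = (\<Sum>c\<in>A n. if sz c \<le> t then 1 else 0)"
      by (rule sum.inter_filter[OF fin(2)])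
    also have "\<dots> = (\<Sum>c\<in>A n. indicator {sz c..} t)"
      by (intro sum.cong) (auto simp: indicator_def)
    finally show ?thesis .
  qed
  have M_int: "integrable lborel (\<lambda>t. of_real (M n t) * exp (- (s * of_real t)))"
     "(\<integral>t. of_real (M n t) * exp (- (s * of_real t)) \<partial>lborel) = (\<Sum>c\<in>A n. exp (- (of_real (sz c) * s))) / s"
    if "Re s > 0" for s n
    using exp_tail_integral[OF that] by (simp_all add: M_sum sum_distrib_right sum_divide_distrib)
  have M_le: "M n t \<le> N t" "M n t \<le> M m t" if "n \<le> m" for m n t
    unfolding M_def N_def
    using that by (auto intro!: card_mono rev_finite_subset[OF fin(1)[of t]] simp: A_def)
  have M_lim: "(\<lambda>n. M n t) \<longlonglongrightarrow> N t" for t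
  proof (rule tendsto_eventually)
    show "\<forall>\<^sub>F n in sequentially. M n t = N t"
      using eventually_ge_at_top[of "nat \<lceil>t\<rceil>"]
    proof eventually_elim
      case (elim n)
      then have "t \<le> real n" by linarith
      then have "{c \<in> A n. sz c \<le> t} = {c \<in> C. sz c \<le> t}" by (auto simp: A_def)
      then show ?case by (simp add: M_def N_def)
    qed
  qed
  have [measurable]: "N \<in> borel_measurable borel"
  proof (rule borel_measurable_mono, rule monoI)
    show "N x \<le> N y" if "x \<le> y" for x y unfolding N_def using that fin by (auto intro!: card_mono)
  qed
  \<comment> \<open>The finite sets \<open>A n\<close> eventually contain every finite subset of
    \<open>C\<close>, so the unordered sum is the limit of its partial sums over
    \<open>A n\<close>.\<close>
  have A_lim: "filterlim A (finite_subsets_at_top C) sequentially"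
    unfolding filterlim_finite_subsets_at_top
  proof (intro allI impI)
    fix X assume X: "finite X \<and> X \<subseteq> C"
    then obtain n0 where n0: "\<And>c. c \<in> X \<Longrightarrow> sz c \<le> real n0"
      by (metis (no_types, lifting) Max_ge finite_imageI imageI order_trans real_arch_simple)
    show "\<forall>\<^sub>F n in sequentially. finite (A n) \<and> X \<subseteq> A n \<and> A n \<subseteq> C"
      using eventually_ge_at_top[of n0]
    proof eventually_elim
      case (elim n)
      then show ?case using fin X n0 by (force simp: A_def)
    qed
  qed
  have S: "(\<lambda>n. \<Sum>c\<in>A n. exp (- (of_real (sz c) * s))) \<longlonglongrightarrow> dirichlet_gf C sz s" if "Re s > a" for s
  proof -
    have "(\<lambda>c. exp (- of_real (sz c) * s)) summable_on C"
    proof (rule abs_summable_summable)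
      show "(\<lambda>c. norm (exp (- of_real (sz c) * s))) summable_on C"
        using summable[OF that] by simp
    qed
    then have "((\<lambda>c. exp (- of_real (sz c) * s)) has_sum dirichlet_gf C sz s) C"
      unfolding dirichlet_gf_def by (rule has_sum_infsum)
    then show ?thesis unfolding has_sum_def using filterlim_compose[OF _ A_lim] by force
  qed
  have N_int: "integrable lborel (\<lambda>t. N t * exp (- (\<sigma> * t)))" if \<sigma>: "\<sigma> > a" for \<sigma>
  proof (rule integrable_monotone_convergence)
    have r: "complex_of_real (M n t * exp (- (\<sigma> * t))) = of_real (M n t) * exp (- (of_real \<sigma> * of_real t))" for n t
      by (simp flip: exp_of_real)
    have i: "integrable lborel (\<lambda>t. complex_of_real (M n t * exp (- (\<sigma> * t))))" for n
      unfolding r using M_int(1)[of "of_real \<sigma>"] \<sigma> a by simp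
    show "integrable lborel (\<lambda>t. M n t * exp (- (\<sigma> * t)))" for n
      using integrable_Re[OF i] by simp
    have I: "complex_of_real (\<integral>t. M n t * exp (- (\<sigma> * t)) \<partial>lborel) = (\<Sum>c\<in>A n. exp (- (of_real (sz c) * of_real \<sigma>))) / of_real \<sigma>" for n
      unfolding integral_complex_of_real[symmetric] r using M_int(2)[of "of_real \<sigma>"] \<sigma> a by simp
    have "(\<lambda>n. Re ((\<Sum>c\<in>A n. exp (- (of_real (sz c) * of_real \<sigma>))) / of_real \<sigma>)) \<longlonglongrightarrow> Re (dirichlet_gf C sz (of_real \<sigma>) / of_real \<sigma>)"
      using \<sigma> a by (intro tendsto_Re tendsto_divide S) auto
    then show "(\<lambda>n. \<integral>t. M n t * exp (- (\<sigma> * t)) \<partial>lborel) \<longlonglongrightarrow> Re (dirichlet_gf C sz (of_real \<sigma>) / of_real \<sigma>)"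
      by (simp only: Re_complex_of_real flip: I)
    show "AE t in lborel. mono (\<lambda>n. M n t * exp (- (\<sigma> * t)))"
      by (intro AE_I2 monoI mult_right_mono M_le) auto
    show "AE t in lborel. (\<lambda>n. M n t * exp (- (\<sigma> * t))) \<longlonglongrightarrow> N t * exp (- (\<sigma> * t))"
      by (intro AE_I2 tendsto_intros M_lim)
  qed measurable
  have "sz c \<ge> 0" if "c \<in> C" for c using C that by (auto simp: combinatorial_class_def)
  then have "N t = 0" if "t < 0" for t using that by (force simp: N_def card_eq_0_iff)
  moreover have "N t \<ge> 0" for t by (simp add: N_def)
  ultimately show conv: "laplace_conv (\<lambda>t. of_real (N t)) a"
    using N_int by (simp add: laplace_conv_def)
  assume s: "Re s > a"
  have "(\<lambda>n. \<integral>t. of_real (M n t) * exp (- (s * of_real t)) \<partial>lborel) \<longlonglongrightarrow> (\<integral>t. of_real (N t) * exp (- (s * of_real t)) \<partial>lborel)"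
  proof (rule integral_dominated_convergence[where w="\<lambda>t. N t * exp (- (Re s * t))"])
    show "integrable lborel (\<lambda>t. N t * exp (- (Re s * t)))" using N_int[OF s] .
    show "AE t in lborel. (\<lambda>n. of_real (M n t) * exp (- (s * of_real t))) \<longlonglongrightarrow> of_real (N t) * exp (- (s * of_real t))"
      by (intro AE_I2 tendsto_intros M_lim)
    show "AE t in lborel. norm (of_real (M n t) * exp (- (s * of_real t))) \<le> N t * exp (- (Re s * t))" for n
      using M_le(1)[of n n] by (intro AE_I2) (auto simp: norm_mult M_def)
    show "(\<lambda>t. of_real (M n t) * exp (- (s * of_real t))) \<in> borel_measurable lborel" for n
      using M_int(1)[of s n] s a by (intro borel_measurable_integrable) auto
  qed measurable
  moreover have "(\<lambda>n. \<integral>t. of_real (M n t) * exp (- (s * of_real t)) \<partial>lborel) \<longlonglongrightarrow> dirichlet_gf C sz s / s"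
    unfolding M_int(2)[OF le_less_trans[OF a s]] using s a by (intro tendsto_divide S) auto
  ultimately show "laplace (\<lambda>t. of_real (N t)) s = dirichlet_gf C sz s / s"
    unfolding laplace_def by (rule LIMSEQ_unique)
qed

subsection \<open>Combinatorial classes\<close>

lemma irrational_gf_support:
  assumes "combinatorial_class C sz"
  shows "gps_support (irrational_gf C sz) = sz ` C"
proof -
  have "finite {c \<in> C. sz c = l}" for l using assms by (auto simp: combinatorial_class_def)
  then show ?thesis by (auto simp: gps_support_def irrational_gf_def card_eq_0_iff)
qed

lemma card_upto_eq_coeff_upto:
  assumes C: "combinatorial_class C sz"
  shows "of_nat (card {c \<in> C. sz c \<le> x}) = gps_coeff_upto (irrational_gf C sz) x"
proof -
  let ?L = "{l \<in> sz ` C. l \<le> x}"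
  have fin: "finite {c \<in> C. sz c \<le> x}" by (rule finite_upto[OF C])
  have "?L = sz ` {c \<in> C. sz c \<le> x}" by auto
  then have finL: "finite ?L" using fin by simp
  have "{c \<in> C. sz c \<le> x} = (\<Union>l\<in>?L. {c \<in> C. sz c = l})" by auto
  then have "card {c \<in> C. sz c \<le> x} = card (\<Union>l\<in>?L. {c \<in> C. sz c = l})" by simp
  also have "\<dots> = (\<Sum>l\<in>?L. card {c \<in> C. sz c = l})"
    using finL C by (intro card_UN_disjoint) (auto simp: combinatorial_class_def)
  finally show ?thesis
    unfolding gps_coeff_upto_def irrational_gf_support[OF C] by (simp add: irrational_gf_def)
qed

section \<open>From the generalised power series to the Dirichlet series, by grouping objects of
  equal size\<close>

lemma bij_betw_fibres:
  "bij_betw snd (SIGMA l:sz ` C. {c \<in> C. sz c = l}) C"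
  by (auto simp: bij_betw_def inj_on_def image_iff)

text \<open>The point \<open>exp (- \<sigma>)\<close> lies below the radius, hence below some
  \<open>r\<close> at which the series converges absolutely. Sizes being nonnegative,
  \<open>r powr l\<close> dominates \<open>exp (- (l * \<sigma>))\<close>.\<close>

lemma summable_on_class:
  assumes C: "combinatorial_class C sz" and \<rho>: "gps_radius (irrational_gf C sz) = ereal \<rho>" "0 < \<rho>"
    and \<sigma>: "\<sigma> > ln (1 / \<rho>)"
  shows "(\<lambda>c. exp (- (sz c * \<sigma>))) summable_on C"
proof -
  let ?c = "irrational_gf C sz"
  have fin: "finite {c \<in> C. sz c = l}" and pos: "c \<in> C \<Longrightarrow> sz c \<ge> 0" for l c
    using C by (auto simp: combinatorial_class_def)
  have "exp (- \<sigma>) < exp (- ln (1 / \<rho>))" using \<sigma> by simp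
  also have "\<dots> = \<rho>" using \<rho> by (simp add: ln_div)
  finally have "ereal (exp (- \<sigma>)) < gps_radius ?c" using \<rho> by simp
  then obtain r where r: "exp (- \<sigma>) < r" "(\<lambda>l. norm (?c l) * r powr l) summable_on sz ` C"
    unfolding gps_radius_def less_Sup_iff irrational_gf_support[OF C] by auto
  have le: "exp (- (l * \<sigma>)) \<le> r powr l" if "l \<in> sz ` C" for l
  proof -
    have "exp (- (l * \<sigma>)) = exp (- \<sigma>) powr l" by (simp add: powr_def)
    also have "\<dots> \<le> r powr l" using r(1) pos that by (intro powr_mono2) auto
    finally show ?thesis .
  qed
  have "(\<lambda>l. norm (?c l) * exp (- (l * \<sigma>))) summable_on sz ` C"
    by (rule summable_on_comparison_test[OF r(2)]) (auto intro!: mult_left_mono le)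
  moreover have "((\<lambda>c. exp (- (sz (snd (l, c)) * \<sigma>))) has_sum norm (?c l) * exp (- (l * \<sigma>))) {c \<in> C. sz c = l}" for l
    using has_sum_finite[OF fin, of "\<lambda>c. exp (- (sz (snd (l, c)) * \<sigma>))" l]
    by (simp add: irrational_gf_def)
  ultimately have "(\<lambda>p. exp (- (sz (snd p) * \<sigma>))) summable_on (SIGMA l:sz ` C. {c \<in> C. sz c = l})"
    by (intro summable_on_SigmaI[where g="\<lambda>l. norm (?c l) * exp (- (l * \<sigma>))"]) auto
  then show ?thesis
    using summable_on_reindex_bij_betw[OF bij_betw_fibres[of sz C], of "\<lambda>c. exp (- (sz c * \<sigma>))"] by simp
qed

text \<open>In the strip \<open>\<bar>Im s\<bar> < pi\<close> the principal logarithm of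
  \<open>exp (- s)\<close> is \<open>- s\<close>, so principal powers become exponentials. The terms
  of equal size are then collected by absolute convergence.\<close>

lemma gps_eval_exp:
  assumes C: "combinatorial_class C sz" and \<rho>: "gps_radius (irrational_gf C sz) = ereal \<rho>" "0 < \<rho>"
    and s: "Re s > ln (1 / \<rho>)" "\<bar>Im s\<bar> < pi"
  shows "gps_eval (irrational_gf C sz) (exp (- s)) = dirichlet_gf C sz s"
proof -
  let ?f = "\<lambda>c. exp (- of_real (sz c) * s)"
  let ?S = "SIGMA l:sz ` C. {c \<in> C. sz c = l}"
  have fin: "finite {c \<in> C. sz c = l}" for l
    using C by (auto simp: combinatorial_class_def)
  have "?f summable_on C"
  proof (rule abs_summable_summable)
    show "(\<lambda>c. norm (?f c)) summable_on C"
      using summable_on_class[OF C \<rho> s(1)] by simp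
  qed
  then have summ: "(\<lambda>p. ?f (snd p)) summable_on ?S"
    by (subst summable_on_reindex_bij_betw[OF bij_betw_fibres])
  have powr: "exp (- s) powr of_real l = exp (- of_real l * s)" for l
  proof -
    have "Ln (exp (- s)) = - s" using s(2) by (intro Ln_exp) auto
    then show ?thesis by (simp add: powr_def mult.commute)
  qed
  have "gps_eval (irrational_gf C sz) (exp (- s)) = (\<Sum>\<^sub>\<infinity>l\<in>sz ` C. \<Sum>\<^sub>\<infinity>c\<in>{c \<in> C. sz c = l}. ?f (snd (l, c)))"
    unfolding gps_eval_def irrational_gf_support[OF C]
    by (intro infsum_cong) (simp add: powr infsum_finite[OF fin] irrational_gf_def)
  also have "\<dots> = (\<Sum>\<^sub>\<infinity>p\<in>?S. ?f (snd p))"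
    by (rule infsum_Sigma_banach[OF summ])
  also have "\<dots> = dirichlet_gf C sz s"
    unfolding dirichlet_gf_def by (rule infsum_reindex_bij_betw[OF bij_betw_fibres])
  finally show ?thesis .
qed

text \<open>Both arguments are below \<open>pi / 2\<close> in modulus, so their sum stays within the
  principal range and the logarithms add.\<close>

lemma powr_times_Re_pos:
  assumes "Re u > 0" "Re v > 0"
  shows "(u * v) powr z = u powr z * v powr (z::complex)"
proof -
  have nz: "u \<noteq> 0" "v \<noteq> 0" using assms by auto
  have "\<bar>Im (Ln u)\<bar> < pi / 2" "\<bar>Im (Ln v)\<bar> < pi / 2"
    using assms by (intro Re_Ln_pos_lt_imp; simp)+
  then have "Ln (u * v) = Ln u + Ln v"
    using nz by (intro Ln_times_simple) auto
  then show ?thesis using nz by (simp add: powr_def exp_add algebra_simps)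
qed

text \<open>Under \<open>z = exp (- s)\<close> the factor \<open>1 - z / \<rho>\<close> becomes \<open>s - ln (1 / \<rho>)\<close> times the unit
  \<open>E s\<close>, which is absorbed into the numerator.\<close>

lemma powr_singularity_exp:
  fixes \<rho> :: real
  assumes \<rho>: "0 < \<rho>" "\<rho> < 1"
    and g: "g analytic_on (cball 0 \<rho> - \<real>\<^sub>\<le>\<^sub>0)" and h: "h analytic_on (cball 0 \<rho> - \<real>\<^sub>\<le>\<^sub>0)"
    and F: "\<And>s. Re s > ln (1 / \<rho>) \<Longrightarrow> \<bar>Im s\<bar> < pi \<Longrightarrow>
       F s = g (exp (- s)) + h (exp (- s)) / (1 - exp (- s) / of_real \<rho>) powr \<alpha>"
  shows "powr_singularity (\<lambda>s. F s / s) (ln (1 / \<rho>)) \<alpha> (h (of_real \<rho>) / of_real (ln (1 / \<rho>)))"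
proof -
  define a where "a = ln (1 / \<rho>)"
  have a: "a > 0" using \<rho> by (simp add: a_def)
  have exp_a: "exp (- complex_of_real a) = of_real \<rho>"
    using \<rho> by (simp add: a_def ln_div exp_of_real)
  have "complex_of_real \<rho> \<in> cball 0 \<rho> - \<real>\<^sub>\<le>\<^sub>0" using \<rho> by (auto simp: complex_nonpos_Reals_iff)
  then have "g analytic_on {of_real \<rho>}" "h analytic_on {of_real \<rho>}"
    using g h by (auto intro: analytic_on_subset)
  then obtain e1 e2 where e: "e1 > 0" "g holomorphic_on ball (of_real \<rho>) e1" "e2 > 0" "h holomorphic_on ball (of_real \<rho>) e2"
    by (auto simp: analytic_at_ball)
  have "\<forall>\<^sub>F s in nhds (complex_of_real a). exp (- s) \<in> ball (of_real \<rho>) (min e1 e2)"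
  proof -
    have "((\<lambda>s. exp (- s)) \<longlongrightarrow> exp (- complex_of_real a)) (nhds (of_real a))"
      by (intro tendsto_intros filterlim_ident)
    then show ?thesis
      unfolding exp_a using e(1,3) by (intro topological_tendstoD) auto
  qed
  then obtain r1 where r1: "r1 > 0" "\<And>s. s \<in> ball (complex_of_real a) r1 \<Longrightarrow> exp (- s) \<in> ball (of_real \<rho>) (min e1 e2)"
    unfolding eventually_nhds_metric mem_ball by (metis dist_commute)
  \<comment> \<open>Since \<open>exp (- a) = \<rho>\<close>, this is
    \<open>1 - exp (- s) / \<rho>\<close>, with a simple zero at \<open>a\<close>. The quotient
    \<open>E\<close> removes that zero and takes the value \<open>deriv \<phi> a = 1\<close>
    there.\<close>
  define \<phi> where "\<phi> s = 1 - exp (- (s - complex_of_real a))" for s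
  define E where "E s = (if s = of_real a then deriv \<phi> (of_real a) else (\<phi> s - \<phi> (of_real a)) / (s - of_real a))" for s
  have "\<phi> holomorphic_on UNIV" unfolding \<phi>_def by (intro holomorphic_intros)
  then have E_hol: "E holomorphic_on UNIV"
    unfolding E_def by (intro pole_lemma) auto
  have "(\<phi> has_field_derivative 1) (at (of_real a))"
    unfolding \<phi>_def by (auto intro!: derivative_eq_intros)
  then have E_a: "E (of_real a) = 1" by (simp add: E_def DERIV_imp_deriv)
  have E_eq: "1 - exp (- s) / of_real \<rho> = (s - of_real a) * E s" for s
  proof -
    have "exp (- (s - of_real a)) = exp (- s) / exp (- complex_of_real a)"
      by (simp flip: exp_diff)
    then have "\<phi> s = 1 - exp (- s) / of_real \<rho>" by (simp only: \<phi>_def exp_a)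
    moreover have "\<phi> (of_real a) = 0" by (simp add: \<phi>_def)
    then have "\<phi> s = (s - of_real a) * E s" by (auto simp: E_def)
    ultimately show ?thesis by (simp only:)
  qed
  \<comment> \<open>Positive real part keeps \<open>E\<close> off the branch cut and allows the
    power of the product to be split by \<open>powr_times_Re_pos\<close>.\<close>
  have "\<forall>\<^sub>F s in nhds (complex_of_real a). 0 < Re (E s)"
  proof -
    have "isCont E (of_real a)"
      using E_hol by (auto dest!: holomorphic_on_imp_continuous_on simp: continuous_on_eq_continuous_at)
    then have "((\<lambda>s. Re (E s)) \<longlongrightarrow> Re (E (of_real a))) (nhds (of_real a))"
      by (intro tendsto_Re) (simp add: isCont_def tendsto_nhds_iff)
    then show ?thesis by (rule order_tendstoD(1)) (simp add: E_a)
  qed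
  then obtain r2 where r2: "r2 > 0" "\<And>s. s \<in> ball (complex_of_real a) r2 \<Longrightarrow> 0 < Re (E s)"
    unfolding eventually_nhds_metric mem_ball by (metis dist_commute)
  \<comment> \<open>The bound \<open>a\<close> keeps \<open>0\<close> out of the disk, so division
    by \<open>s\<close> is harmless; the bound \<open>pi\<close> keeps the disk inside the strip
    where \<open>F\<close> is given.\<close>
  define r where "r = min (min r1 r2) (min a pi)"
  have r: "r > 0" "r \<le> r1" "r \<le> r2" "r \<le> a" "r \<le> pi" using r1 r2 a by (auto simp: r_def)
  let ?B = "ball (complex_of_real a) r"
  have nz: "s \<noteq> 0" if "s \<in> ?B" for s using that r a by (auto simp: dist_norm)
  have E_pos: "E s \<notin> \<real>\<^sub>\<le>\<^sub>0" if "s \<in> ?B" for s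
    using r2(2)[of s] that r(3) by (auto simp: complex_nonpos_Reals_iff)
  have exp_hol: "(\<lambda>s. f (exp (- s))) holomorphic_on ?B" if "f holomorphic_on ball (of_real \<rho>) e'" "min e1 e2 \<le> e'" for f e'
  proof -
    have "(f \<circ> (\<lambda>s. exp (- s))) holomorphic_on ?B"
    proof (rule holomorphic_on_compose_gen[OF _ that(1)])
      show "(\<lambda>s. exp (- s)) ` ?B \<subseteq> ball (of_real \<rho>) e'"
      proof (rule image_subsetI)
        fix s assume "s \<in> ?B"
        then have "s \<in> ball (of_real a) r1" using r(2) by simp
        from r1(2)[OF this] show "exp (- s) \<in> ball (of_real \<rho>) e'" using that(2) by (auto simp: min_le_iff_disj)
      qed
    qed (intro holomorphic_intros)
    then show ?thesis by (simp add: comp_def)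
  qed
  define G where "G s = g (exp (- s)) / s" for s
  define H where "H s = h (exp (- s)) * E s powr (- \<alpha>) / s" for s
  have "G holomorphic_on ?B"
    unfolding G_def using nz by (intro holomorphic_intros exp_hol[OF e(2)]) auto
  moreover have "H holomorphic_on ?B"
    unfolding H_def using nz E_pos
    by (intro holomorphic_intros exp_hol[OF e(4)] holomorphic_on_subset[OF E_hol]) auto
  moreover have "H (of_real a) = h (of_real \<rho>) / of_real a" by (simp add: H_def E_a exp_a)
  moreover have "F w / w = G w + H w * (w - of_real a) powr (- \<alpha>)" if w: "w \<in> ?B" "Re w > a" for w
  proof -
    have "\<bar>Im w\<bar> \<le> dist (of_real a) w" using abs_Im_le_cmod[of "of_real a - w"] by (simp add: dist_norm)
    then have "\<bar>Im w\<bar> < pi" using w r by auto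
    then have "F w = g (exp (- w)) + h (exp (- w)) / ((w - of_real a) * E w) powr \<alpha>"
      using w F[of w] by (simp add: a_def[symmetric] E_eq)
    also have "((w - of_real a) * E w) powr \<alpha> = (w - of_real a) powr \<alpha> * E w powr \<alpha>"
      using w r r2(2)[of w] by (intro powr_times_Re_pos) auto
    finally show ?thesis
      by (simp add: G_def H_def powr_minus add_divide_distrib field_simps)
  qed
  ultimately show ?thesis
    using r(1) unfolding powr_singularity_def a_def[symmetric] by blast
qed

text \<open>When \<open>h \<rho> = 0\<close> the comparison function is identically zero, and
  asymptotic equivalence would force the count to vanish eventually. The equivalence is therefore
  stated for \<open>h \<rho> \<noteq> 0\<close>, while the limit of the quotient covers both
  cases.\<close>

theorem theorem1:
  fixes C :: "'a set" and sz :: "'a \<Rightarrow> real"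
    and \<rho> :: real and \<alpha> :: complex and g h :: "complex \<Rightarrow> complex"
  assumes "irrational_class C sz"
    and "primitive_class C sz"
    and "gps_radius (irrational_gf C sz) = ereal \<rho>"
    and "0 < \<rho>" and "\<rho> < 1"
    and "\<alpha> \<notin> \<int>\<^sub>\<le>\<^sub>0"
    and "g analytic_on (cball 0 \<rho> - \<real>\<^sub>\<le>\<^sub>0)"
    and "h analytic_on (cball 0 \<rho> - \<real>\<^sub>\<le>\<^sub>0)"
    and "\<And>z. z \<in> ball 0 \<rho> - \<real>\<^sub>\<le>\<^sub>0 \<Longrightarrow>
           gps_eval (irrational_gf C sz) z = g z + h z / (1 - z / of_real \<rho>) powr \<alpha>"
  shows "(\<forall>x\<ge>0. of_nat (card {c \<in> C. sz c \<le> x}) = gps_coeff_upto (irrational_gf C sz) x) \<and>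
         (h (of_real \<rho>) \<noteq> 0 \<longrightarrow>
            (\<lambda>x::real. of_nat (card {c \<in> C. sz c \<le> x}) :: complex) \<sim>[at_top]
            (\<lambda>x. h (of_real \<rho>) / (of_real (ln (1 / \<rho>)) * Gamma \<alpha>)
                   * of_real (\<rho> powr (- x)) * of_real x powr (\<alpha> - 1))) \<and>
         ((\<lambda>x::real. of_nat (card {c \<in> C. sz c \<le> x})
                       / (of_real (\<rho> powr (- x)) * of_real x powr (\<alpha> - 1)))
            \<longlongrightarrow> h (of_real \<rho>) / (of_real (ln (1 / \<rho>)) * Gamma \<alpha>)) at_top"
proof -
  define a where "a = ln (1 / \<rho>)"
  define N where "N t = real (card {c \<in> C. sz c \<le> t})" for t
  define L where "L = h (of_real \<rho>) / (of_real a * Gamma \<alpha>)"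
  have C: "combinatorial_class C sz" using assms(1) by (simp add: irrational_class_def)
  have a: "a > 0" using assms(4,5) by (simp add: a_def)
  note fin = finite_upto[OF C]
  note sum = summable_on_class[OF C assms(3,4), folded a_def]
  have conv: "laplace_conv (\<lambda>t. of_real (N t)) a"
    and lap: "\<And>s. Re s > a \<Longrightarrow> laplace (\<lambda>t. of_real (N t)) s = dirichlet_gf C sz s / s"
    using laplace_counting[OF C less_imp_le[OF a] sum] by (simp_all add: N_def)
  have sing: "line_singularities (dirichlet_gf C sz) a = {of_real a}"
  proof -
    \<comment> \<open>The radius bound inside \<open>primitive_class\<close> is determined by the
      generating function, so it coincides with \<open>\<rho>\<close>.\<close>
    obtain \<rho>' where "gps_radius (irrational_gf C sz) = ereal \<rho>'"
      "line_singularities (dirichlet_gf C sz) (ln (1 / \<rho>')) = {of_real (ln (1 / \<rho>'))}"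
      using assms(2) by (auto simp: primitive_class_def)
    then show ?thesis using assms(3) by (simp add: a_def)
  qed
  have lim: "((\<lambda>x. of_real (exp (- (a * x)) * N x) * of_real x powr (1 - \<alpha>)) \<longlongrightarrow> (h (of_real \<rho>) / of_real a) / Gamma \<alpha>) at_top"
  proof (rule laplace_tauberian_monotone)
    show "mono N" unfolding N_def by (intro monoI) (auto intro!: card_mono fin)
    show "N t = 0" if "t < 0" for t
      using C that by (force simp: N_def combinatorial_class_def card_eq_0_iff)
    show "laplace_conv (\<lambda>t. of_real (N t)) a" by (rule conv)
    show "continues_at (laplace (\<lambda>t. of_real (N t))) a s" if s: "Re s = a" "s \<noteq> of_real a" for s
    proof -
      have "s \<notin> line_singularities (dirichlet_gf C sz) a" using s sing by simp
      then obtain r G where r: "r > 0" "G holomorphic_on ball s r"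
         "\<And>w. w \<in> ball s r \<Longrightarrow> Re w > a \<Longrightarrow> G w = dirichlet_gf C sz w"
        using s by (auto simp: line_singularities_def)
      \<comment> \<open>The centre has real part \<open>a\<close>, so a disk of radius at most
        \<open>a\<close> misses the pole introduced by dividing by \<open>w\<close>.\<close>
      have "w \<noteq> 0" if "w \<in> ball s (min r a)" for w
        using that s a abs_Re_le_cmod[of s] by (auto simp: dist_norm)
      then have "(\<lambda>w. G w / w) holomorphic_on ball s (min r a)"
        by (intro holomorphic_intros holomorphic_on_subset[OF r(2)]) auto
      then show ?thesis
        unfolding continues_at_def using r a lap by (intro exI[of _ "min r a"] conjI exI[of _ "\<lambda>w. G w / w"]) auto
    qed
    have "dirichlet_gf C sz s = g (exp (- s)) + h (exp (- s)) / (1 - exp (- s) / of_real \<rho>) powr \<alpha>"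
      if s: "Re s > ln (1 / \<rho>)" "\<bar>Im s\<bar> < pi" for s
    proof -
      have "exp (- Re s) < exp (- ln (1 / \<rho>))" using s by simp
      also have "\<dots> = \<rho>" using assms(4) by (simp add: ln_div)
      finally have "exp (- s) \<in> ball 0 \<rho>" by simp
      \<comment> \<open>On the negative axis the principal logarithm has imaginary part
        \<open>pi\<close>, which the strip excludes.\<close>
      moreover have "exp (- s) \<notin> \<real>\<^sub>\<le>\<^sub>0"
      proof
        assume "exp (- s) \<in> \<real>\<^sub>\<le>\<^sub>0"
        then have "Re (exp (- s)) < 0 \<and> Im (exp (- s)) = 0"
          by (metis complex_eq_0 complex_nonpos_Reals_iff exp_not_eq_zero less_eq_real_def power_zero_numeral add_0_right zero_eq_power2 complex_eqI zero_complex.sel)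
        then have "Im (Ln (exp (- s))) = pi" by (simp add: Im_Ln_eq_pi)
        moreover have "Ln (exp (- s)) = - s" using s(2) by (intro Ln_exp) auto
        ultimately show False using s(2) by auto
      qed
      ultimately show ?thesis using assms(9)[of "exp (- s)"] gps_eval_exp[OF C assms(3,4) s] by simp
    qed
    then have "powr_singularity (\<lambda>s. dirichlet_gf C sz s / s) a \<alpha> (h (of_real \<rho>) / of_real a)"
      unfolding a_def using assms(4,5,7,8) by (intro powr_singularity_exp) auto
    then show "powr_singularity (laplace (\<lambda>t. of_real (N t))) a \<alpha> (h (of_real \<rho>) / of_real a)"
      unfolding powr_singularity_def by (simp only: lap cong: conj_cong imp_cong)
  qed (use a assms(6) in auto)
  have quot: "((\<lambda>x. of_nat (card {c \<in> C. sz c \<le> x}) / (of_real (\<rho> powr (- x)) * of_real x powr (\<alpha> - 1))) \<longlongrightarrow> L) at_top"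
  proof -
    have "((\<lambda>x. of_real (exp (- (a * x)) * N x) * of_real x powr (1 - \<alpha>)) \<longlongrightarrow> L) at_top"
      using lim by (simp add: L_def)
    then show ?thesis
    proof (rule Lim_transform_eventually)
      show "\<forall>\<^sub>F x in at_top. of_real (exp (- (a * x)) * N x) * of_real x powr (1 - \<alpha>) =
        of_nat (card {c \<in> C. sz c \<le> x}) / (of_real (\<rho> powr (- x)) * of_real x powr (\<alpha> - 1))"
        using eventually_gt_at_top[of 0]
      proof eventually_elim
        case (elim x)
        have "complex_of_real (\<rho> powr (- x)) = inverse (of_real (exp (- (a * x))))"
          using assms(4) by (simp add: powr_def a_def ln_div mult.commute flip: exp_minus of_real_inverse)
        moreover have "complex_of_real x powr (\<alpha> - 1) = inverse (of_real x powr (1 - \<alpha>))"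
          using powr_minus[of "complex_of_real x" "1 - \<alpha>"] by simp
        ultimately show ?case by (simp only: N_def) (simp add: divide_inverse)
      qed
    qed
  qed
  have asymp: "(\<lambda>x::real. of_nat (card {c \<in> C. sz c \<le> x}) :: complex) \<sim>[at_top]
      (\<lambda>x. L * of_real (\<rho> powr (- x)) * of_real x powr (\<alpha> - 1))" if "h (of_real \<rho>) \<noteq> 0"
  proof (rule asymp_equivI')
    have L0: "L \<noteq> 0" using that a assms(6) by (simp add: L_def Gamma_eq_zero_iff)
    have "((\<lambda>x. of_nat (card {c \<in> C. sz c \<le> x}) / (of_real (\<rho> powr (- x)) * of_real x powr (\<alpha> - 1)) / L) \<longlongrightarrow> L / L) at_top"
      by (intro tendsto_divide quot tendsto_const L0)
    then show "((\<lambda>x. of_nat (card {c \<in> C. sz c \<le> x}) / (L * of_real (\<rho> powr (- x)) * of_real x powr (\<alpha> - 1))) \<longlongrightarrow> 1) at_top"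
      using L0 by (simp add: mult_ac)
  qed
  show ?thesis
    using card_upto_eq_coeff_upto[OF C] asymp quot unfolding L_def a_def by blast
qed

end
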